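(* Let $n\ge 2$, let $n_0$ be the product of the distinct prime divisors of $n$, and let $1=d_1<d_2<\dots<d_{\tau(n_0)}=n_0$ be the divisors of $n_0$, where $\tau(n_0)$ is the number of divisors of $n_0$. Let $L(Q_n)$ and $L(D_n)$ be the Laplacian matrices of the generating graphs $\Gamma(Q_n)$ and $\Gamma(D_n)$. If $\lambda$ is an eigenvalue of $L(D_n)$, then $2\lambda$ is an eigenvalue of $L(Q_n)$. Explicitly, the spectrum of $L(Q_n)$ is $$\begin{pmatrix}0&4\varphi(n)-2\mu(d_2)\frac{\varphi(n)}{\varphi(d_2)}&\cdots&4\varphi(n)-2\mu(d_{\tau(n_0)})\frac{\varphi(n)}{\varphi(d_{\tau(n_0)})}&4\varphi(n)&2n&2(n+\varphi(n))\\2(n-\varphi(n))+1&\varphi(d_2)&\cdots&\varphi(d_{\tau(n_0)})&2n-n_0&2\varphi(n)-1&1\end{pmatrix}.$$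
   Context: For $n\ge 2$, the dicyclic group is $Q_n=\langle x,y : x^{2n}=1,\ x^n=y^2,\ yx=x^{-1}y\rangle$, of order $4n$, and the dihedral group is $D_n=\langle r,s : r^n=s^2=1,\ srs=r^{-1}\rangle$, of order $2n$. The generating graph $\Gamma(G)$ of a group $G$ is the simple undirected graph with vertex set $G$ in which two distinct vertices $g,h$ are adjacent iff $\langle g,h\rangle=G$. The Laplacian matrix of a graph is $D-A$, where $A$ is the adjacency matrix and $D$ the diagonal matrix of vertex degrees. $\varphi$ is Euler's totient function and $\mu$ the Möbius function. In the two-row notation for a spectrum, the top row lists eigenvalues and the bottom row their multiplicities; the spectrum is a multiset (if the same number appears in several columns, the multiplicities add, and columns with multiplicity $0$ are void). *)

theory Defs
  imports
    "HOL-Number_Theory.Number_Theory"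
    "HOL-Computational_Algebra.Squarefree"
    "HOL-Algebra.Generated_Groups"
    "Jordan_Normal_Form.Char_Poly"
    "Graph_Theory.Pair_Digraph"
begin

section \<open>Groups given by generators and relations\<close>

text \<open>
  The group \<open>\<langle>'a | R\<rangle>\<close> has one generator for each element of the type \<open>'a\<close>; a pair
  \<open>(r, s) \<in> R\<close> of words stands for the relation \<open>r = s\<close>. The group is the set of all words in the
  generators and their formal inverses, modulo the least congruence that contains \<open>R\<close> and
  cancels \<open>a a\<^sup>-\<^sup>1\<close> and \<open>a\<^sup>-\<^sup>1 a\<close>.
\<close>

datatype 'a letter = Gen 'a | Inv 'a

type_synonym 'a word = "'a letter list"

inductive word_eq :: "('a word \<times> 'a word) set \<Rightarrow> 'a word \<Rightarrow> 'a word \<Rightarrow> bool"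
  for R :: "('a word \<times> 'a word) set" where
  refl: "word_eq R u u"
| sym: "word_eq R u v \<Longrightarrow> word_eq R v u"
| trans: "word_eq R u v \<Longrightarrow> word_eq R v w \<Longrightarrow> word_eq R u w"
| cancel_Gen_Inv: "word_eq R (u @ [Gen a, Inv a] @ v) (u @ v)"
| cancel_Inv_Gen: "word_eq R (u @ [Inv a, Gen a] @ v) (u @ v)"
| relation: "(r, s) \<in> R \<Longrightarrow> word_eq R (u @ r @ v) (u @ s @ v)"

definition word_class :: "('a word \<times> 'a word) set \<Rightarrow> 'a word \<Rightarrow> 'a word set" where
  "word_class R u = {v. word_eq R u v}"

definition presented_group :: "('a word \<times> 'a word) set \<Rightarrow> 'a word set monoid" where
  "presented_group R =
    \<lparr>carrier = range (word_class R),
     monoid.mult = (\<lambda>A B. {w. \<exists>u\<in>A. \<exists>v\<in>B. word_eq R (u @ v) w}),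
     one = word_class R []\<rparr>"

datatype gen2 = gen_a | gen_b

text \<open>The first generator plays the role of \<open>x\<close>, the second one that of \<open>y\<close>.\<close>

definition dicyclic_relations :: "nat \<Rightarrow> (gen2 word \<times> gen2 word) set" where
  "dicyclic_relations n =
    {(replicate (2 * n) (Gen gen_a), []),
     (replicate n (Gen gen_a), [Gen gen_b, Gen gen_b]),
     ([Gen gen_b, Gen gen_a], [Inv gen_a, Gen gen_b])}"

definition dicyclic_group :: "nat \<Rightarrow> gen2 word set monoid" where
  "dicyclic_group n = presented_group (dicyclic_relations n)"

text \<open>The first generator plays the role of \<open>r\<close>, the second one that of \<open>s\<close>.\<close>

definition dihedral_relations :: "nat \<Rightarrow> (gen2 word \<times> gen2 word) set" where
  "dihedral_relations n =
    {(replicate n (Gen gen_a), []),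
     ([Gen gen_b, Gen gen_b], []),
     ([Gen gen_b, Gen gen_a, Gen gen_b], [Inv gen_a])}"

definition dihedral_group :: "nat \<Rightarrow> gen2 word set monoid" where
  "dihedral_group n = presented_group (dihedral_relations n)"


section \<open>Generating graph and Laplacian matrix\<close>

text \<open>A simple undirected graph is a loop-free symmetric \<^typ>\<open>'a pair_pre_digraph\<close>; the degree of
  a vertex is then its out-degree.\<close>

definition generating_graph :: "('a, 'b) monoid_scheme \<Rightarrow> 'a pair_pre_digraph" where
  "generating_graph G =
    \<lparr>pverts = carrier G,
     parcs = {(g, h). g \<in> carrier G \<and> h \<in> carrier G \<and> g \<noteq> h \<and> generate G {g, h} = carrier G}\<rparr>"

text \<open>
  Matrices are indexed by \<open>0, \<dots>, N - 1\<close>, so the matrices of a graph depend on an enumeration \<open>vs\<close>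
  of its vertices (a distinct list whose set of elements is the vertex set).
\<close>

definition adjacency_matrix :: "'a pair_pre_digraph \<Rightarrow> 'a list \<Rightarrow> complex mat" where
  "adjacency_matrix G vs =
    Matrix.mat (length vs) (length vs) (\<lambda>(i, j). if (vs ! i, vs ! j) \<in> parcs G then 1 else 0)"

definition degree_matrix :: "'a pair_pre_digraph \<Rightarrow> 'a list \<Rightarrow> complex mat" where
  "degree_matrix G vs = mat_diag (length vs) (\<lambda>i. of_nat (out_degree (with_proj G) (vs ! i)))"

definition laplacian_matrix :: "'a pair_pre_digraph \<Rightarrow> 'a list \<Rightarrow> complex mat" where
  "laplacian_matrix G vs = degree_matrix G vs - adjacency_matrix G vs"

text \<open>The spectrum with algebraic multiplicities. The entries are taken to be complex so that it has
  as many elements as the matrix has rows.\<close>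

definition spectrum_mset :: "complex mat \<Rightarrow> complex multiset" where
  "spectrum_mset A = proots (char_poly A)"


section \<open>Moebius function\<close>

definition moebius_mu :: "nat \<Rightarrow> int" where
  "moebius_mu n = (if squarefree n then (- 1) ^ card (prime_factors n) else 0)"


section \<open>The presented groups are groups of the expected orders\<close>

lemma word_eq_append_left: "word_eq R u v \<Longrightarrow> word_eq R (w @ u) (w @ v)"
proof (induction rule: word_eq.induct)
  case (cancel_Gen_Inv u a v)
  show ?case using word_eq.cancel_Gen_Inv[of R "w @ u" a v] by simp
next
  case (cancel_Inv_Gen u a v)
  show ?case using word_eq.cancel_Inv_Gen[of R "w @ u" a v] by simp
next
  case (relation r s u v)
  then show ?case using word_eq.relation[of r s R "w @ u" v] by simp
qed (auto intro: word_eq.intros)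

lemma word_eq_append_right: "word_eq R u v \<Longrightarrow> word_eq R (u @ w) (v @ w)"
proof (induction rule: word_eq.induct)
  case (cancel_Gen_Inv u a v)
  show ?case using word_eq.cancel_Gen_Inv[of R u a "v @ w"] by simp
next
  case (cancel_Inv_Gen u a v)
  show ?case using word_eq.cancel_Inv_Gen[of R u a "v @ w"] by simp
next
  case (relation r s u v)
  then show ?case using word_eq.relation[of r s R u "v @ w"] by simp
qed (auto intro: word_eq.intros)

lemma word_eq_append: "word_eq R u v \<Longrightarrow> word_eq R u' v' \<Longrightarrow> word_eq R (u @ u') (v @ v')"
  by (meson word_eq.trans word_eq_append_left word_eq_append_right)

lemma word_class_eq_iff: "word_class R u = word_class R v \<longleftrightarrow> word_eq R u v"
  unfolding word_class_def
  by (auto intro: word_eq.refl word_eq.sym word_eq.trans)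

lemma carrier_presented_group: "carrier (presented_group R) = range (word_class R)"
  by (simp add: presented_group_def)

lemma one_presented_group: "\<one>\<^bsub>presented_group R\<^esub> = word_class R []"
  by (simp add: presented_group_def)

lemma mult_presented_group:
  "word_class R u \<otimes>\<^bsub>presented_group R\<^esub> word_class R v = word_class R (u @ v)"
proof -
  have "(\<exists>u'. word_eq R u u' \<and> (\<exists>v'. word_eq R v v' \<and> word_eq R (u' @ v') w)) \<longleftrightarrow>
    word_eq R (u @ v) w" for w
    by (meson word_eq.refl word_eq.trans word_eq_append)
  then show ?thesis
    by (simp add: presented_group_def word_class_def)
qed

lemma word_eq_left_inverse: "\<exists>v. word_eq R (v @ u) []"
proof (induction u)
  case Nil
  show ?case by (auto intro!: exI[of _ "[]"] word_eq.refl)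
next
  case (Cons l u)
  then obtain v where v: "word_eq R (v @ u) []" by blast
  have "\<exists>l'. word_eq R (v @ [l'] @ l # u) (v @ u)"
  proof (cases l)
    case (Gen a)
    then show ?thesis using word_eq.cancel_Inv_Gen[of R v a u] by auto
  next
    case (Inv a)
    then show ?thesis using word_eq.cancel_Gen_Inv[of R v a u] by auto
  qed
  then obtain l' where "word_eq R ((v @ [l']) @ l # u) (v @ u)" by auto
  then show ?case using v by (blast intro: word_eq.trans)
qed

lemma group_presented_group: "group (presented_group R)"
proof (rule groupI)
  fix x assume "x \<in> carrier (presented_group R)"
  then obtain u where x: "x = word_class R u" by (auto simp: carrier_presented_group)
  obtain v where "word_eq R (v @ u) []" using word_eq_left_inverse by blast
  then show "\<exists>y\<in>carrier (presented_group R). y \<otimes>\<^bsub>presented_group R\<^esub> x = \<one>\<^bsub>presented_group R\<^esub>"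
    by (auto simp: x carrier_presented_group one_presented_group mult_presented_group word_class_eq_iff)
qed (auto simp: carrier_presented_group one_presented_group mult_presented_group)

lemma group_dicyclic_group: "group (dicyclic_group n)"
  by (simp add: dicyclic_group_def group_presented_group)

lemma group_dihedral_group: "group (dihedral_group n)"
  by (simp add: dihedral_group_def group_presented_group)


lemma word_eq_replicate_commute:
  assumes "word_eq R [Gen b, Gen a] [Inv a, Gen b]"
  shows "word_eq R (Gen b # replicate i (Gen a)) (replicate i (Inv a) @ [Gen b])"
proof (induction i)
  case 0
  show ?case by (simp add: word_eq.refl)
next
  case (Suc i)
  have "word_eq R ([Gen b, Gen a] @ replicate i (Gen a)) ([Inv a, Gen b] @ replicate i (Gen a))"
    using assms by (rule word_eq_append_right)
  moreover have "word_eq R ([Inv a] @ Gen b # replicate i (Gen a))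
      ([Inv a] @ replicate i (Inv a) @ [Gen b])"
    using Suc by (rule word_eq_append_left)
  ultimately show ?case by (auto intro: word_eq.trans)
qed

lemma word_eq_replicate_inverse:
  "word_eq R (replicate i (Gen a) @ replicate i (Inv a)) []"
proof (induction i)
  case 0
  show ?case by (simp add: word_eq.refl)
next
  case (Suc i)
  have "word_eq R (replicate i (Gen a) @ [Gen a, Inv a] @ replicate i (Inv a))
      (replicate i (Gen a) @ replicate i (Inv a))"
    by (rule word_eq.cancel_Gen_Inv)
  then have "word_eq R (replicate i (Gen a) @ [Gen a, Inv a] @ replicate i (Inv a)) []"
    using Suc by (rule word_eq.trans)
  moreover have "replicate i (Gen a) @ [Gen a, Inv a] @ replicate i (Inv a) =
      replicate (Suc i) (Gen a) @ replicate (Suc i) (Inv a)"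
    by (metis append.assoc append_Cons append_Nil replicate_Suc replicate_app_Cons_same)
  ultimately show ?case by metis
qed

lemma word_eq_normal_form:
  fixes R :: "(gen2 word \<times> gen2 word) set"
  defines "a \<equiv> gen_a" and "b \<equiv> gen_b"
  assumes N: "N > 0" and aN: "word_eq R (replicate N (Gen a)) []"
    and bb: "word_eq R [Gen b, Gen b] (replicate m (Gen a))"
    and ba: "word_eq R [Gen b, Gen a] [Inv a, Gen b]"
  shows "\<exists>i<N. \<exists>e. word_eq R u (replicate i (Gen a) @ (if e then [Gen b] else []))"
proof -
  define NF where
    "NF u \<longleftrightarrow> (\<exists>i<N. \<exists>e. word_eq R u (replicate i (Gen a) @ (if e then [Gen b] else [])))" for u
  have NF_eq: "NF u" if "word_eq R u v" "NF v" for u v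
    using that unfolding NF_def by (blast intro: word_eq.trans)
  have a: "NF (Gen a # u)" if u: "NF u" for u
  proof -
    obtain i e where i: "i < N"
      and e: "word_eq R u (replicate i (Gen a) @ (if e then [Gen b] else []))"
      using u unfolding NF_def by blast
    have eq: "word_eq R (Gen a # u) (replicate (Suc i) (Gen a) @ (if e then [Gen b] else []))"
      using word_eq_append_left[OF e, of "[Gen a]"] by simp
    show ?thesis
    proof (cases "Suc i < N")
      case True
      then show ?thesis using eq unfolding NF_def by blast
    next
      case False
      then have "Suc i = N" using i by simp
      then have "word_eq R (Gen a # u) (replicate 0 (Gen a) @ (if e then [Gen b] else []))"
        using eq word_eq_append_right[OF aN, of "if e then [Gen b] else []"]
        by (auto intro: word_eq.trans)
      then show ?thesis using N unfolding NF_def by blast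
    qed
  qed
  have rep_a: "NF (replicate i (Gen a) @ u)" if "NF u" for i u
    using that by (induction i) (auto intro: a)
  have a': "NF (Inv a # u)" if u: "NF u" for u
  proof -
    have "word_eq R ([Inv a] @ replicate N (Gen a) @ u) (Inv a # u)"
      using word_eq_append_left[OF word_eq_append_right[OF aN, of u], of "[Inv a]"] by simp
    moreover have "word_eq R ([] @ [Inv a, Gen a] @ replicate (N - 1) (Gen a) @ u)
        ([] @ replicate (N - 1) (Gen a) @ u)"
      by (rule word_eq.cancel_Inv_Gen)
    moreover have "[] @ [Inv a, Gen a] @ replicate (N - 1) (Gen a) @ u =
        [Inv a] @ replicate N (Gen a) @ u"
      using N by (cases N) auto
    ultimately have "word_eq R (Inv a # u) (replicate (N - 1) (Gen a) @ u)"
      by (metis append_Nil word_eq.sym word_eq.trans)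
    then show ?thesis using rep_a[OF u] NF_eq by blast
  qed
  have rep_a': "NF (replicate i (Inv a) @ u)" if "NF u" for i u
    using that by (induction i) (auto intro: a')
  have Nil: "NF []"
    unfolding NF_def using N by (auto intro!: exI[of _ 0] exI[of _ False] word_eq.refl)
  have b_single: "NF [Gen b]"
    unfolding NF_def using N by (auto intro!: exI[of _ 0] exI[of _ True] word_eq.refl)
  have b: "NF (Gen b # u)" if u: "NF u" for u
  proof -
    obtain i e where e: "word_eq R u (replicate i (Gen a) @ (if e then [Gen b] else []))"
      using u unfolding NF_def by blast
    let ?e = "if e then [Gen b] else []"
    have "word_eq R (Gen b # u) ((Gen b # replicate i (Gen a)) @ ?e)"
      using word_eq_append_left[OF e, of "[Gen b]"] by simp
    moreover have "word_eq R ((Gen b # replicate i (Gen a)) @ ?e)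
        ((replicate i (Inv a) @ [Gen b]) @ ?e)"
      by (intro word_eq_append_right word_eq_replicate_commute ba)
    ultimately have eq: "word_eq R (Gen b # u) (replicate i (Inv a) @ (Gen b # ?e))"
      by (auto intro: word_eq.trans)
    have "NF (Gen b # ?e)"
      using b_single NF_eq[OF bb] rep_a[OF Nil, of m] by auto
    then show ?thesis using NF_eq[OF eq] rep_a' by blast
  qed
  have b': "NF (Inv b # u)" if u: "NF u" for u
  proof -
    let ?v = "replicate m (Inv a) @ u"
    have 1: "word_eq R ([Inv b] @ replicate m (Gen a) @ ?v) (Inv b # u)"
      using word_eq_append_left[OF word_eq_append_right[OF word_eq_replicate_inverse[of R m a],
          of u], of "[Inv b]"] by simp
    have 2: "word_eq R ([Inv b] @ [Gen b, Gen b] @ ?v) ([Inv b] @ replicate m (Gen a) @ ?v)"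
      by (intro word_eq_append_left word_eq_append_right bb)
    have 3: "word_eq R ([Inv b] @ [Gen b, Gen b] @ ?v) (Gen b # ?v)"
      using word_eq.cancel_Inv_Gen[of R "[]" b "Gen b # ?v"] by simp
    from 1 2 3 have "word_eq R (Inv b # u) (Gen b # ?v)"
      by (meson word_eq.sym word_eq.trans)
    then show ?thesis using b[OF rep_a'[OF u]] NF_eq by blast
  qed
  have "NF u" for u
  proof (induction u)
    case Nil
    show ?case by (fact Nil)
  next
    case (Cons l u)
    have "l \<in> {Gen a, Inv a, Gen b, Inv b}"
      unfolding a_def b_def by (cases l; rename_tac g; case_tac g) auto
    then show ?case using Cons a a' b b' by auto
  qed
  then show ?thesis unfolding NF_def .
qed

text \<open>
  Distinct normal forms are told apart by the action of words on the set of all \<open>(i, e)\<close>,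
  \<open>0 \<le> i < N\<close>, where \<open>(i, e)\<close> stands for \<open>a\<^sup>i b\<^sup>e\<close> and letters act by left multiplication.
\<close>

fun act_letter :: "int \<Rightarrow> int \<Rightarrow> gen2 letter \<Rightarrow> int \<times> bool \<Rightarrow> int \<times> bool" where
  "act_letter N m (Gen gen_a) (i, e) = ((i + 1) mod N, e)"
| "act_letter N m (Inv gen_a) (i, e) = ((i - 1) mod N, e)"
| "act_letter N m (Gen gen_b) (i, e) = (if e then ((m - i) mod N, False) else ((- i) mod N, True))"
| "act_letter N m (Inv gen_b) (i, e) = (if e then ((- i) mod N, False) else ((m - i) mod N, True))"

definition act_word :: "int \<Rightarrow> int \<Rightarrow> gen2 word \<Rightarrow> int \<times> bool \<Rightarrow> int \<times> bool" where
  "act_word N m u = foldr (act_letter N m) u"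

lemma act_word_simps [simp]:
  "act_word N m [] s = s"
  "act_word N m (l # u) s = act_letter N m l (act_word N m u s)"
  "act_word N m (u @ v) s = act_word N m u (act_word N m v s)"
  by (simp_all add: act_word_def)

lemma act_letter_closed:
  assumes "N > 0"
  shows "act_letter N m l s \<in> {0..<N} \<times> UNIV"
  using assms by (cases "(N, m, l, s)" rule: act_letter.cases) auto

lemma act_word_closed:
  assumes "N > 0" "s \<in> {0..<N} \<times> UNIV"
  shows "act_word N m u s \<in> {0..<N} \<times> UNIV"
  using assms(2) by (induction u) (simp, metis act_letter_closed act_word_simps(2) assms(1))

lemma act_letter_cancel:
  assumes "s \<in> {0..<N} \<times> UNIV"
  shows "act_letter N m (Gen g) (act_letter N m (Inv g) s) = s"
    "act_letter N m (Inv g) (act_letter N m (Gen g) s) = s"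
  using assms by (cases g; cases s; auto simp: mod_simps)+

lemma act_word_replicate:
  "0 \<le> i \<Longrightarrow> i < N \<Longrightarrow> act_word N m (replicate k (Gen gen_a)) (i, e) = ((i + int k) mod N, e)"
  by (induction k) (auto simp: mod_simps algebra_simps)

lemma act_word_cong:
  assumes "word_eq R u v" "N > 0"
    and rel: "\<And>r s t. (r, s) \<in> R \<Longrightarrow> t \<in> {0..<N} \<times> UNIV \<Longrightarrow> act_word N m r t = act_word N m s t"
  shows "t \<in> {0..<N} \<times> UNIV \<Longrightarrow> act_word N m u t = act_word N m v t"
  using assms(1)
proof (induction arbitrary: t rule: word_eq.induct)
  case (cancel_Gen_Inv u a v)
  show ?case
    using act_letter_cancel(1)[OF act_word_closed[OF assms(2) cancel_Gen_Inv]] by simp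
next
  case (cancel_Inv_Gen u a v)
  show ?case
    using act_letter_cancel(2)[OF act_word_closed[OF assms(2) cancel_Inv_Gen]] by simp
next
  case (relation r s u v)
  show ?case
    using rel[OF relation(1) act_word_closed[OF assms(2) relation(2)]] by simp
qed auto

lemma order_presented_group:
  fixes R :: "(gen2 word \<times> gen2 word) set" and N m :: nat
  assumes N: "N > 0" and aN: "word_eq R (replicate N (Gen gen_a)) []"
    and bb: "word_eq R [Gen gen_b, Gen gen_b] (replicate m (Gen gen_a))"
    and ba: "word_eq R [Gen gen_b, Gen gen_a] [Inv gen_a, Gen gen_b]"
    and rel: "\<And>r s t. (r, s) \<in> R \<Longrightarrow> t \<in> {0..<int N} \<times> UNIV \<Longrightarrow>
      act_word (int N) (int m) r t = act_word (int N) (int m) s t"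
  shows "Coset.order (presented_group R) = 2 * N"
proof -
  define w where "w = (\<lambda>(i, e). replicate i (Gen gen_a) @ (if e then [Gen gen_b] else []))"
  define A where "A = {..<N} \<times> (UNIV :: bool set)"
  have act: "act_word (int N) (int m) (w (i, e)) (0, False) = (int i, e)" if "i < N" for i e
    using that N by (simp add: w_def act_word_replicate)
  have "inj_on (\<lambda>p. word_class R (w p)) A"
  proof (rule inj_onI)
    fix p q assume p: "p \<in> A" and q: "q \<in> A" and "word_class R (w p) = word_class R (w q)"
    then have "word_eq R (w p) (w q)" by (simp add: word_class_eq_iff)
    then have "act_word (int N) (int m) (w p) (0, False) = act_word (int N) (int m) (w q) (0, False)"
      by (rule act_word_cong) (use N rel in auto)
    then show "p = q" using p q unfolding A_def by (cases p; cases q) (auto simp: act)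
  qed
  moreover have "carrier (presented_group R) = (\<lambda>p. word_class R (w p)) ` A"
  proof -
    have "word_class R u \<in> (\<lambda>p. word_class R (w p)) ` A" for u
    proof -
      obtain i e where "i < N"
        "word_eq R u (replicate i (Gen gen_a) @ (if e then [Gen gen_b] else []))"
        using word_eq_normal_form[OF N aN bb ba] by blast
      then have "(i, e) \<in> A" "word_class R u = word_class R (w (i, e))"
        unfolding A_def w_def by (auto simp: word_class_eq_iff)
      then show ?thesis by blast
    qed
    then show ?thesis by (auto simp: carrier_presented_group)
  qed
  ultimately have "Coset.order (presented_group R) = card A"
    by (simp add: Coset.order_def card_image)
  then show ?thesis by (simp add: A_def card_cartesian_product)
qed

lemma order_dicyclic_group:
  assumes "n \<ge> 1"
  shows "Coset.order (dicyclic_group n) = 4 * n"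
proof -
  have rel: "word_eq (dicyclic_relations n) r s" if "(r, s) \<in> dicyclic_relations n" for r s
    using word_eq.relation[OF that, of "[]" "[]"] by simp
  have aN: "word_eq (dicyclic_relations n) (replicate (2 * n) (Gen gen_a)) []"
    and ba: "word_eq (dicyclic_relations n) [Gen gen_b, Gen gen_a] [Inv gen_a, Gen gen_b]"
    by (rule rel, simp add: dicyclic_relations_def)+
  have bb: "word_eq (dicyclic_relations n) [Gen gen_b, Gen gen_b] (replicate n (Gen gen_a))"
    by (rule word_eq.sym, rule rel, simp add: dicyclic_relations_def)
  have "Coset.order (presented_group (dicyclic_relations n)) = 2 * (2 * n)"
  proof (rule order_presented_group[where m = n])
    fix r s t
    assume "(r, s) \<in> dicyclic_relations n" "t \<in> {0..<int (2 * n)} \<times> (UNIV :: bool set)"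
    moreover have "(- int n + i) mod (2 * int n) = (int n + i) mod (2 * int n)" for i
      using mod_add_self2[of "- int n + i" "2 * int n"] by (simp add: algebra_simps)
    ultimately show "act_word (int (2 * n)) (int n) r t = act_word (int (2 * n)) (int n) s t"
      using assms
      by (cases t) (auto simp: dicyclic_relations_def act_word_replicate mod_simps algebra_simps)
  qed (use assms aN bb ba in auto)
  then show ?thesis by (simp add: dicyclic_group_def)
qed

lemma order_dihedral_group:
  assumes "n \<ge> 1"
  shows "Coset.order (dihedral_group n) = 2 * n"
proof -
  have rel: "word_eq (dihedral_relations n) r s" if "(r, s) \<in> dihedral_relations n" for r s
    using word_eq.relation[OF that, of "[]" "[]"] by simp
  have aN: "word_eq (dihedral_relations n) (replicate n (Gen gen_a)) []"
    and bb: "word_eq (dihedral_relations n) [Gen gen_b, Gen gen_b] []"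
    and bab: "word_eq (dihedral_relations n) [Gen gen_b, Gen gen_a, Gen gen_b] [Inv gen_a]"
    by (rule rel, simp add: dihedral_relations_def)+
  have ba: "word_eq (dihedral_relations n) [Gen gen_b, Gen gen_a] [Inv gen_a, Gen gen_b]"
    using word_eq_append_left[OF bb, of "[Gen gen_b, Gen gen_a]"]
      word_eq_append_right[OF bab, of "[Gen gen_b]"]
    by (auto intro: word_eq.sym word_eq.trans)
  have "Coset.order (presented_group (dihedral_relations n)) = 2 * n"
  proof (rule order_presented_group[where m = 0])
    fix r s t
    assume "(r, s) \<in> dihedral_relations n" "t \<in> {0..<int n} \<times> (UNIV :: bool set)"
    then show "act_word (int n) (int 0) r t = act_word (int n) (int 0) s t"
      using assms
      by (cases t) (auto simp: dihedral_relations_def act_word_replicate mod_simps algebra_simps)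
  qed (use assms aN bb ba in auto)
  then show ?thesis by (simp add: dihedral_group_def)
qed

end

(* In both groups every element is a^k b^e with k modulo N (N = 2n for Q_n, N = n for D_n), and whether
   two such elements generate the group depends only on the exponents modulo n. Hence Gamma(Q_n) is the
   two-fold blow-up of Gamma(D_n), and an eigenvector lifted from D_n keeps its shape while its eigenvalue
   doubles. For the spectrum of L(Q_n) there is an explicit orthogonal eigenbasis: indicators of the
   isolated rotations, characters on the rotations a^k with k prime to n, characters of Z/2n on the
   reflections, and two vectors that are constant on these two classes. The eigenvalue of the m-th
   character on reflections is 4 phi(n) minus a sum that vanishes for odd m and is twice a Ramanujan sum
   for even m. *)

theory Submission
  imports Defs
begin

section \<open>Spectra of matrices indexed by lists\<close>

text \<open>Multiplicities are algebraic, so exhibiting eigenvalues is not enough. A family of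
  nonzero, pairwise orthogonal eigenvectors, as many as there are vertices, diagonalises the matrix
  at once, and coinciding eigenvalues need no separate treatment. Why exponents count modulo
  \<open>n\<close>: a reflection squares to \<open>a [^] m\<close>, so a generating pair that
  contains one obtains \<open>a [^] m\<close> for free, and \<open>n = gcd N m\<close>. Characters
  serve different purposes on the two classes. The rotations with exponent prime to \<open>n\<close>
  are joined to all reflections and to nothing else, so any function on them with sum zero is an
  eigenvector, and characters merely supply orthogonal ones. The reflections form a circulant graph,
  which forces the characters of Z/2n. The trivial character is left out on both sides; the missing
  plane of functions constant on each class carries the 2 by 2 matrix with rows (2n, -2n) and (-p,
  p), p = 2 phi(n), with eigenvectors (1, 1) and (2n, -p) for 0 and 2n + p. The multiplicity 2n -
  n_0 is n (odd characters) plus n - n_0 (even ones for which n / gcd is not squarefree, so that mu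
  vanishes).\<close>

lemma sum_set_conv_nth:
  "distinct vs \<Longrightarrow> (\<Sum>u\<in>set vs. g u) = (\<Sum>i = 0..<length vs. g (vs ! i))"
  by (simp add: sum.distinct_set_conv_list sum_list_sum_nth)

text \<open>Orthogonality gives the eigenvector matrix \<open>P\<close> an explicit inverse, namely
  its conjugate transpose with each row divided by a squared norm. Hence \<open>M\<close> is similar
  to a diagonal matrix and the roots of its characteristic polynomial are read off with
  multiplicity.\<close>

lemma proots_char_poly_orthogonal_basis:
  fixes K :: "'a \<Rightarrow> 'a \<Rightarrow> complex" and f :: "'j \<Rightarrow> 'a \<Rightarrow> complex" and lam :: "'j \<Rightarrow> complex"
  assumes vs: "distinct vs"
    and M: "M = Matrix.mat (length vs) (length vs) (\<lambda>(i, j). K (vs ! i) (vs ! j))"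
    and J: "finite J" "card J = length vs"
    and eig: "\<And>j v. j \<in> J \<Longrightarrow> v \<in> set vs \<Longrightarrow> (\<Sum>u\<in>set vs. K v u * f j u) = lam j * f j v"
    and orth: "\<And>j k. j \<in> J \<Longrightarrow> k \<in> J \<Longrightarrow> j \<noteq> k \<Longrightarrow> (\<Sum>u\<in>set vs. f j u * cnj (f k u)) = 0"
    and nz: "\<And>j. j \<in> J \<Longrightarrow> \<exists>u\<in>set vs. f j u \<noteq> 0"
  shows "proots (char_poly M) = (\<Sum>j\<in>J. {#lam j#})"
proof -
  obtain js where js: "set js = J" "distinct js" using J(1) finite_distinct_list by blast
  define N where "N = length vs"
  have len: "length js = N" using js J by (simp add: N_def distinct_card[symmetric])
  have jsJ: "js ! k \<in> J" if "k < N" for k using that js len nth_mem by blast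
  define c where "c j = (\<Sum>u\<in>set vs. f j u * cnj (f j u))" for j
  have c: "c j \<noteq> 0" if "j \<in> J" for j
  proof -
    obtain u where u: "u \<in> set vs" "f j u \<noteq> 0" using nz[OF \<open>j \<in> J\<close>] by blast
    have "c j = of_real (\<Sum>u\<in>set vs. (cmod (f j u))\<^sup>2)"
      unfolding c_def by (simp add: complex_norm_square del: of_real_power)
    moreover have "(\<Sum>u\<in>set vs. (cmod (f j u))\<^sup>2) > 0"
      by (rule sum_pos2[OF _ u(1)]) (use u(2) in auto)
    ultimately show ?thesis by (metis less_irrefl of_real_eq_0_iff)
  qed
  define P where "P = Matrix.mat N N (\<lambda>(i, k). f (js ! k) (vs ! i))"
  define Q where "Q = Matrix.mat N N (\<lambda>(k, i). cnj (f (js ! k) (vs ! i)) / c (js ! k))"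
  define D where "D = mat_diag N (\<lambda>k. lam (js ! k))"
  have car: "M \<in> carrier_mat N N" "P \<in> carrier_mat N N" "Q \<in> carrier_mat N N" "D \<in> carrier_mat N N"
    by (auto simp: M P_def Q_def D_def N_def)
  have QP: "Q * P = 1\<^sub>m N"
  proof (rule eq_matI)
    fix k l assume "k < dim_row (1\<^sub>m N :: complex mat)" "l < dim_col (1\<^sub>m N :: complex mat)"
    then have kl: "k < N" "l < N" by auto
    have "(Q * P) $$ (k, l) = (\<Sum>u\<in>set vs. f (js ! l) u * cnj (f (js ! k) u)) / c (js ! k)"
      using kl by (simp add: P_def Q_def scalar_prod_def sum_set_conv_nth[OF vs] N_def
          sum_divide_distrib mult.commute)
    also have "\<dots> = (if k = l then 1 else 0)"
    proof (cases "k = l")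
      case True then show ?thesis using c[OF jsJ[OF kl(1)]] by (simp add: c_def)
    next
      case False
      then have "js ! l \<noteq> js ! k" using kl js len by (simp add: nth_eq_iff_index_eq)
      then show ?thesis using orth jsJ kl False by simp
    qed
    finally show "(Q * P) $$ (k, l) = 1\<^sub>m N $$ (k, l)" using kl by simp
  qed (use car in auto)
  have PQ: "P * Q = 1\<^sub>m N" by (rule mat_mult_left_right_inverse[OF car(3,2) QP])
  have MP: "M * P = P * D"
  proof (rule eq_matI)
    fix i k assume "i < dim_row (P * D)" "k < dim_col (P * D)"
    then have ik: "i < N" "k < N" using car by auto
    have "(M * P) $$ (i, k) = (\<Sum>u\<in>set vs. K (vs ! i) u * f (js ! k) u)"
      using ik by (simp add: M P_def scalar_prod_def sum_set_conv_nth[OF vs] N_def)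
    also have "\<dots> = lam (js ! k) * f (js ! k) (vs ! i)"
      using eig[OF jsJ[OF ik(2)]] ik by (simp add: N_def)
    also have "\<dots> = (P * D) $$ (i, k)"
      using ik unfolding D_def mat_diag_mult_right[OF car(2)] by (simp add: P_def)
    finally show "(M * P) $$ (i, k) = (P * D) $$ (i, k)" .
  qed (use car in auto)
  have "M = M * (P * Q)" using car PQ by simp
  also have "\<dots> = P * D * Q"
    using assoc_mult_mat[OF car(1,2,3)] by (simp only: MP)
  finally have "similar_mat M D" by (intro similar_matI[of _ _ P Q]) (use car PQ QP in auto)
  then have "char_poly M = char_poly D" by (rule char_poly_similar)
  also have "\<dots> = (\<Prod>a\<leftarrow>diag_mat D. [:- a, 1:])"
    by (rule char_poly_upper_triangular[OF car(4)]) (auto simp: D_def mat_diag_def)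
  also have "diag_mat D = map lam js"
    using len by (intro nth_equalityI) (auto simp: D_def mat_diag_def diag_mat_def)
  also have "(\<Prod>a\<leftarrow>map lam js. [:- a, 1:]) = (\<Prod>j\<in>J. [:- lam j, 1:])"
    using prod.distinct_set_conv_list[OF js(2), of "\<lambda>j. [:- lam j, 1:]"] js(1) by (simp add: comp_def)
  finally have cp: "char_poly M = (\<Prod>j\<in>J. [:- lam j, 1:])" .
  show ?thesis
    unfolding cp by (subst proots_prod) simp_all
qed

text \<open>Allows eigenvectors to be treated as functions on vertices instead of vectors over
  positions; distinctness of \<open>vs\<close> makes the two views equivalent.\<close>

lemma eigenvalue_mat_iff:
  fixes K :: "'a \<Rightarrow> 'a \<Rightarrow> complex"
  assumes vs: "distinct vs"
    and M: "M = Matrix.mat (length vs) (length vs) (\<lambda>(i, j). K (vs ! i) (vs ! j))"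
  shows "eigenvalue M \<theta> \<longleftrightarrow>
    (\<exists>f. (\<exists>u\<in>set vs. f u \<noteq> 0) \<and> (\<forall>v\<in>set vs. (\<Sum>u\<in>set vs. K v u * f u) = \<theta> * f v))"
proof
  assume "eigenvalue M \<theta>"
  then obtain w where w: "w \<in> carrier_vec (length vs)" "w \<noteq> 0\<^sub>v (length vs)" "M *\<^sub>v w = \<theta> \<cdot>\<^sub>v w"
    by (auto simp: eigenvalue_def eigenvector_def M)
  define f where "f u = w $ inv_into {..<length vs} ((!) vs) u" for u
  have f: "f (vs ! i) = w $ i" if "i < length vs" for i
    using that vs by (simp add: f_def inv_into_f_f inj_on_nth)
  have "\<exists>i<length vs. w $ i \<noteq> 0"
  proof (rule ccontr)
    assume "\<not> ?thesis"
    then have "w = 0\<^sub>v (length vs)" using w(1) by (intro eq_vecI) auto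
    then show False using w(2) by simp
  qed
  then have "\<exists>u\<in>set vs. f u \<noteq> 0" using f by (metis nth_mem)
  moreover have "(\<Sum>u\<in>set vs. K v u * f u) = \<theta> * f v" if "v \<in> set vs" for v
  proof -
    obtain i where i: "i < length vs" "v = vs ! i" using \<open>v \<in> set vs\<close> by (metis in_set_conv_nth)
    have "(M *\<^sub>v w) $ i = (\<Sum>u\<in>set vs. K v u * f u)"
      using i w(1) by (simp add: M scalar_prod_def sum_set_conv_nth[OF vs] f)
    then show ?thesis using i w by (simp add: f)
  qed
  ultimately show "\<exists>f. (\<exists>u\<in>set vs. f u \<noteq> 0) \<and> (\<forall>v\<in>set vs. (\<Sum>u\<in>set vs. K v u * f u) = \<theta> * f v)"
    by blast
next
  assume "\<exists>f. (\<exists>u\<in>set vs. f u \<noteq> 0) \<and> (\<forall>v\<in>set vs. (\<Sum>u\<in>set vs. K v u * f u) = \<theta> * f v)"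
  then obtain f where f: "\<exists>u\<in>set vs. f u \<noteq> 0"
    "\<And>v. v \<in> set vs \<Longrightarrow> (\<Sum>u\<in>set vs. K v u * f u) = \<theta> * f v" by blast
  define w where "w = Matrix.vec (length vs) (\<lambda>i. f (vs ! i))"
  have "w \<noteq> 0\<^sub>v (length vs)"
  proof
    assume w0: "w = 0\<^sub>v (length vs)"
    obtain i where "i < length vs" "f (vs ! i) \<noteq> 0" using f(1) by (metis in_set_conv_nth)
    moreover have "w $ i = 0" using \<open>i < length vs\<close> by (simp add: w0)
    ultimately show False by (simp add: w_def)
  qed
  moreover have "M *\<^sub>v w = \<theta> \<cdot>\<^sub>v w"
  proof (rule eq_vecI)
    fix i assume "i < dim_vec (\<theta> \<cdot>\<^sub>v w)"
    then have i: "i < length vs" by (simp add: w_def)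
    have "(M *\<^sub>v w) $ i = (\<Sum>u\<in>set vs. K (vs ! i) u * f u)"
      using i by (simp add: M w_def scalar_prod_def sum_set_conv_nth[OF vs])
    then show "(M *\<^sub>v w) $ i = (\<theta> \<cdot>\<^sub>v w) $ i" using i f(2) by (simp add: w_def)
  qed (simp add: M w_def)
  moreover have "w \<in> carrier_vec (dim_row M)" "dim_row M = length vs" by (simp_all add: M w_def)
  ultimately show "eigenvalue M \<theta>"
    unfolding eigenvalue_def eigenvector_def by auto
qed

definition laplacian_entry :: "'a pair_pre_digraph \<Rightarrow> 'a \<Rightarrow> 'a \<Rightarrow> complex" where
  "laplacian_entry \<Gamma> x y =
    (if x = y then of_nat (out_degree (with_proj \<Gamma>) x) else 0) - (if (x, y) \<in> parcs \<Gamma> then 1 else 0)"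

lemma laplacian_matrix_eq_mat:
  assumes "distinct vs"
  shows "laplacian_matrix \<Gamma> vs =
    Matrix.mat (length vs) (length vs) (\<lambda>(i, j). laplacian_entry \<Gamma> (vs ! i) (vs ! j))"
  using assms
  by (intro eq_matI) (auto simp: laplacian_matrix_def degree_matrix_def adjacency_matrix_def
      mat_diag_def laplacian_entry_def nth_eq_iff_index_eq)

text \<open>The degree counts neighbours, so the diagonal term can be distributed over them as
  copies of \<open>F v\<close>.\<close>

lemma sum_laplacian_entry:
  assumes "finite V" "v \<in> V" "parcs \<Gamma> \<subseteq> V \<times> V"
  shows "(\<Sum>u\<in>V. laplacian_entry \<Gamma> v u * F u) = (\<Sum>u\<in>{u\<in>V. (v, u) \<in> parcs \<Gamma>}. F v - F u)"
proof -
  have "out_arcs (with_proj \<Gamma>) v = Pair v ` {u\<in>V. (v, u) \<in> parcs \<Gamma>}"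
    using assms(3) by (auto simp: out_arcs_def)
  then have deg: "out_degree (with_proj \<Gamma>) v = card {u\<in>V. (v, u) \<in> parcs \<Gamma>}"
    by (simp add: out_degree_def card_image inj_on_def)
  have "(\<Sum>u\<in>V. laplacian_entry \<Gamma> v u * F u) =
      (\<Sum>u\<in>V. (if v = u then of_nat (out_degree (with_proj \<Gamma>) v) * F v else 0)
        - (if (v, u) \<in> parcs \<Gamma> then F u else 0))"
    by (intro sum.cong) (auto simp: laplacian_entry_def left_diff_distrib)
  also have "\<dots> = of_nat (out_degree (with_proj \<Gamma>) v) * F v - (\<Sum>u\<in>{u\<in>V. (v, u) \<in> parcs \<Gamma>}. F u)"
    using assms(1,2) by (simp add: sum_subtractf sum.delta sum.inter_filter)
  finally show ?thesis by (simp add: deg sum_subtractf)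
qed

section \<open>Ramanujan sums\<close>

definition unity_root :: "nat \<Rightarrow> int \<Rightarrow> complex" where
  "unity_root n k = cis (2 * pi * of_int k / of_nat n)"

lemma unity_root_add: "unity_root n (k + l) = unity_root n k * unity_root n l"
  by (simp add: unity_root_def cis_mult add_divide_distrib algebra_simps)

lemma cnj_unity_root: "cnj (unity_root n k) = unity_root n (- k)"
  by (simp add: unity_root_def cis_cnj)

lemma unity_root_nonzero [simp]: "unity_root n k \<noteq> 0"
  by (simp add: unity_root_def)

lemma unity_root_eq_1_iff:
  assumes "n > 0"
  shows "unity_root n k = 1 \<longleftrightarrow> int n dvd k"
proof
  assume "unity_root n k = 1"
  then have "cos (2 * pi * of_int k / of_nat n) = 1"
    unfolding unity_root_def by (metis cis.simps(1) one_complex.simps(1))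
  then obtain x :: int where "2 * pi * of_int k / of_nat n = of_int x * 2 * pi"
    by (auto simp: cos_one_2pi_int)
  then have "real_of_int k = of_int (x * int n)"
    using assms by (simp add: field_simps)
  then have "k = x * int n" by (simp only: of_int_eq_iff)
  then show "int n dvd k" by simp
next
  assume "int n dvd k"
  then obtain x where "k = int n * x" by (elim dvdE)
  then have "2 * pi * of_int k / of_nat n = 2 * pi * real_of_int x"
    using assms by simp
  then show "unity_root n k = 1" unfolding unity_root_def by (simp only: cis_multiple_2pi Ints_of_int)
qed

lemma unity_root_cong:
  assumes "n > 0" "[k = l] (mod int n)"
  shows "unity_root n k = unity_root n l"
proof -
  have "unity_root n (k - l) = 1"
    using assms by (simp add: unity_root_eq_1_iff cong_iff_dvd_diff)
  then show ?thesis using unity_root_add[of n "k - l" l] by simp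
qed

lemma unity_root_mult_cancel:
  "g > 0 \<Longrightarrow> unity_root (g * d) (int g * k) = unity_root d k"
  by (simp add: unity_root_def mult.assoc)

text \<open>Shifting the summation index by one multiplies the sum by \<open>unity_root n m\<close>;
  if this factor is not 1, the sum must vanish.\<close>

lemma sum_unity_root:
  assumes "n > 0"
  shows "(\<Sum>k\<in>{0..<int n}. unity_root n (m * k)) = (if int n dvd m then of_nat n else 0)"
proof (cases "int n dvd m")
  case True
  then have "unity_root n (m * k) = 1" for k using assms by (simp add: unity_root_eq_1_iff)
  then show ?thesis using True by simp
next
  case False
  let ?S = "\<Sum>k\<in>{0..<int n}. unity_root n (m * k)"
  have "unity_root n m * ?S = (\<Sum>k\<in>{0..<int n}. unity_root n (m * (k + 1)))"
    by (simp add: sum_distrib_left unity_root_add distrib_left mult.commute)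
  also have "\<dots> = ?S"
    by (rule sum.reindex_bij_witness[of _ "\<lambda>k. (k - 1) mod int n" "\<lambda>k. (k + 1) mod int n"])
      (use assms in \<open>auto simp: mod_simps intro!: unity_root_cong cong_mult cong_refl simp: cong_def\<close>)
  finally have "(unity_root n m - 1) * ?S = 0" by (simp add: algebra_simps)
  then show ?thesis using False assms by (simp add: unity_root_eq_1_iff)
qed

text \<open>Least residues starting at 0, so that arguments can be reduced by \<open>mod\<close>.
  This differs from \<open>totatives\<close> only for \<open>n = 1\<close>, where the residue is 0
  instead of 1.\<close>

definition units_mod :: "nat \<Rightarrow> int set" where
  "units_mod n = {k \<in> {0..<int n}. coprime k (int n)}"

lemma finite_units_mod [simp]: "finite (units_mod n)"
  unfolding units_mod_def by (rule finite_subset[of _ "{0..<int n}"]) auto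

lemma card_units_mod: "card (units_mod n) = totient n"
proof (cases "n \<le> 1")
  case True
  then consider "n = 0" | "n = 1" by linarith
  then show ?thesis
  proof cases
    case 2
    have "units_mod 1 = {0}" by (auto simp: units_mod_def)
    with 2 show ?thesis by simp
  qed (simp add: units_mod_def)
next
  case False
  have "units_mod n = int ` totatives n"
  proof (intro equalityI subsetI)
    fix k assume k: "k \<in> units_mod n"
    then have "k \<noteq> 0" using False by (auto simp: units_mod_def)
    then have "nat k \<in> totatives n" "k = int (nat k)"
      using k by (auto simp: units_mod_def in_totatives_iff coprime_int_iff[symmetric])
    then show "k \<in> int ` totatives n" by blast
  next
    fix k assume "k \<in> int ` totatives n"
    then show "k \<in> units_mod n"
      using totatives_less[of _ n] False by (auto simp: units_mod_def in_totatives_iff)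
  qed
  then show ?thesis by (simp add: card_image totient_def)
qed

lemma coprime_int_iff_prime_factors:
  assumes "n > 0"
  shows "coprime k (int n) \<longleftrightarrow> (\<forall>p\<in>prime_factors n. \<not> int p dvd k)"
proof
  assume cop: "coprime k (int n)"
  show "\<forall>p\<in>prime_factors n. \<not> int p dvd k"
  proof (intro ballI notI)
    fix p assume "p \<in> prime_factors n" "int p dvd k"
    then have "int p dvd k" "int p dvd int n" "prime p" by auto
    with cop have "is_unit (int p)" by (meson coprime_common_divisor)
    with \<open>prime p\<close> show False by simp
  qed
next
  assume *: "\<forall>p\<in>prime_factors n. \<not> int p dvd k"
  show "coprime k (int n)"
  proof (rule coprimeI)
    fix c assume c: "c dvd k" "c dvd int n"
    show "is_unit c"
    proof (rule ccontr)
      assume "\<not> is_unit c"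
      then have "nat \<bar>c\<bar> \<noteq> 1" by auto
      then obtain p where p: "prime p" "p dvd nat \<bar>c\<bar>" using prime_factor_nat by blast
      then have "int p dvd c" by (simp add: int_dvd_int_iff[symmetric] del: int_dvd_int_iff)
      then have "int p dvd k" "int p dvd int n" using c by (blast intro: dvd_trans)+
      with p(1) assms * show False by (auto simp: prime_factors_dvd)
    qed
  qed
qed

lemma prod_primes_dvd_iff:
  fixes k :: "'a :: factorial_semiring_gcd"
  assumes "finite S" "\<And>p. p \<in> S \<Longrightarrow> prime p"
  shows "\<Prod>S dvd k \<longleftrightarrow> (\<forall>p\<in>S. p dvd k)"
  using assms
proof (induction S rule: finite_induct)
  case (insert p S)
  have "coprime p (\<Prod>S)"
    using insert by (intro prod_coprime_right primes_coprime) auto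
  then show ?case using insert by (auto intro: divides_mult dvd_mult_left dvd_mult_right)
qed simp

lemma prod_prime_factors_squarefree:
  fixes n :: nat
  assumes "squarefree n"
  shows "\<Prod>(prime_factors n) = n"
proof -
  have "n \<noteq> 0" using assms by (metis not_squarefree_0)
  then have "n = (\<Prod>p\<in>prime_factors n. p ^ multiplicity p n)"
    by (simp add: prime_factorization_nat)
  also have "\<dots> = \<Prod>(prime_factors n)"
    using assms \<open>n \<noteq> 0\<close> by (intro prod.cong) (auto simp: squarefree_factorial_semiring')
  finally show ?thesis ..
qed

text \<open>A set of prime divisors of \<open>n\<close> has product \<open>n\<close> only if it
  contains all of them and \<open>n\<close> is squarefree, so at most one summand survives. The
  right-hand side is the form in which inclusion-exclusion over prime divisors delivers the sum of
  primitive roots of unity.\<close>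

lemma moebius_mu_eq_sum:
  assumes "n > 0"
  shows "moebius_mu n = (\<Sum>S\<in>Pow (prime_factors n). (- 1) ^ card S * (if \<Prod>S = n then 1 else 0))"
proof -
  let ?P = "prime_factors n"
  have S: "S = ?P \<and> squarefree n" if "S \<subseteq> ?P" "\<Prod>S = n" for S
  proof
    have fin: "finite S" using that(1) by (rule finite_subset) simp
    have "p \<in> S" if p: "p \<in> ?P" for p
    proof -
      have "p dvd \<Prod>S" using p \<open>\<Prod>S = n\<close> by auto
      then obtain q where "q \<in> S" "p dvd q"
        using prime_dvd_prod_iff[OF fin, of p "\<lambda>x. x"] p by auto
      then show ?thesis
        using p \<open>S \<subseteq> ?P\<close> primes_dvd_imp_eq[of p q] by auto
    qed
    then show "S = ?P" using that(1) by blast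
    have "squarefree (\<Prod>S)"
      using that(1) by (intro squarefree_prod_coprime primes_coprime squarefree_prime) auto
    then show "squarefree n" using that(2) by simp
  qed
  show ?thesis
  proof (cases "squarefree n")
    case True
    have "\<Prod>?P = n" using True by (rule prod_prime_factors_squarefree)
    then have "(\<Sum>S\<in>Pow ?P. (- 1) ^ card S * (if \<Prod>S = n then 1 else 0 :: int)) =
        (\<Sum>S\<in>{?P}. (- 1) ^ card S * (if \<Prod>S = n then 1 else 0))"
      using S by (intro sum.mono_neutral_right) auto
    then show ?thesis using True \<open>\<Prod>?P = n\<close> by (simp add: moebius_mu_def)
  next
    case False
    then have "(\<Sum>S\<in>Pow ?P. (- 1) ^ card S * (if \<Prod>S = n then 1 else 0 :: int)) = 0"
      using S by (intro sum.neutral) auto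
    then show ?thesis using False by (simp add: moebius_mu_def)
  qed
qed

text \<open>The multiples of \<open>e\<close> below \<open>n\<close> yield all roots of unity of
  order dividing \<open>n div e\<close>, and these sum to zero unless there is only one.\<close>

lemma sum_unity_root_multiples:
  assumes "n > 0" "e dvd n"
  shows "(\<Sum>k\<in>{0..<int n}. (if int e dvd k then 1 else 0) * unity_root n k) = (if e = n then 1 else 0)"
proof -
  obtain q where q: "n = e * q" using assms by (elim dvdE)
  have pos: "e > 0" "q > 0" using assms q by auto
  have "(\<Sum>k\<in>{0..<int n}. (if int e dvd k then 1 else 0) * unity_root n k) =
      (\<Sum>k\<in>{k\<in>{0..<int n}. int e dvd k}. unity_root n k)"
    by (simp add: sum.If_cases if_distrib[of "\<lambda>x. x * _"] Int_def cong: if_cong)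
  also have "\<dots> = (\<Sum>j\<in>{0..<int q}. unity_root q (1 * j))"
    by (rule sum.reindex_bij_witness[of _ "\<lambda>j. int e * j" "\<lambda>k. k div int e"])
      (use pos q in \<open>auto simp: unity_root_mult_cancel zero_le_mult_iff
        pos_imp_zdiv_nonneg_iff elim!: dvdE\<close>)
  also have "\<dots> = (if e = n then 1 else 0)"
    unfolding sum_unity_root[OF pos(2)] using pos q by auto
  finally show ?thesis .
qed

text \<open>The indicator of coprimality is expanded by inclusion-exclusion over sets of prime divisors.\<close>

theorem sum_primitive_unity_roots:
  assumes "n > 0"
  shows "(\<Sum>k\<in>units_mod n. unity_root n k) = of_int (moebius_mu n)"
proof -
  let ?P = "prime_factors n"
  have ind: "(if coprime k (int n) then 1 else 0 :: complex) =
      (\<Sum>S\<in>Pow ?P. (- 1) ^ card S * (if int (\<Prod>S) dvd k then 1 else 0))" for k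
  proof -
    have "coprime k (int n) \<longleftrightarrow> (\<forall>p\<in>?P. \<not> int p dvd k)"
      using assms by (rule coprime_int_iff_prime_factors)
    then have "(if coprime k (int n) then 1 else 0 :: complex) =
        (\<Prod>p\<in>?P. (if int p dvd k then - 1 else 0) + 1)"
      by (auto simp: prod_eq_1_iff intro!: prod_zero prod.neutral[symmetric])
    also have "\<dots> = (\<Sum>S\<in>Pow ?P. \<Prod>p\<in>S. if int p dvd k then - 1 else 0)"
      by (simp add: prod_add)
    also have "\<dots> = (\<Sum>S\<in>Pow ?P. (- 1) ^ card S * (if int (\<Prod>S) dvd k then 1 else 0))"
    proof (rule sum.cong)
      fix S assume "S \<in> Pow ?P"
      then have S: "finite S" "\<And>p. p \<in> S \<Longrightarrow> prime p" by (auto intro: finite_subset)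
      have "int (\<Prod>S) dvd k \<longleftrightarrow> (\<forall>p\<in>S. int p dvd k)"
        using prod_primes_dvd_iff[OF S, of "nat \<bar>k\<bar>"] by (simp add: int_dvd_int_iff[symmetric] del: int_dvd_int_iff)
      then show "(\<Prod>p\<in>S. if int p dvd k then - 1 else 0 :: complex) =
          (- 1) ^ card S * (if int (\<Prod>S) dvd k then 1 else 0)"
        using S(1) by (auto intro!: prod_zero)
    qed simp
    finally show ?thesis .
  qed
  have dvd: "\<Prod>S dvd n" if "S \<subseteq> ?P" for S
    using that prod_primes_dvd_iff[of S n] by (auto intro: finite_subset)
  have "(\<Sum>k\<in>units_mod n. unity_root n k) =
      (\<Sum>k\<in>{0..<int n}. (if coprime k (int n) then 1 else 0) * unity_root n k)"
    unfolding units_mod_def by (intro sum.mono_neutral_cong_left) auto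
  also have "\<dots> = (\<Sum>k\<in>{0..<int n}. \<Sum>S\<in>Pow ?P.
      (- 1) ^ card S * ((if int (\<Prod>S) dvd k then 1 else 0) * unity_root n k))"
    unfolding ind by (simp only: sum_distrib_right mult.assoc)
  also have "\<dots> = (\<Sum>S\<in>Pow ?P. (- 1) ^ card S *
      (\<Sum>k\<in>{0..<int n}. (if int (\<Prod>S) dvd k then 1 else 0) * unity_root n k))"
    by (subst sum.swap) (simp only: sum_distrib_left)
  also have "\<dots> = (\<Sum>S\<in>Pow ?P. (- 1) ^ card S * (if \<Prod>S = n then 1 else 0))"
  proof (rule sum.cong)
    fix S assume "S \<in> Pow ?P"
    then have "\<Prod>S dvd n" by (intro dvd) simp
    then show "(- 1) ^ card S *
        (\<Sum>k\<in>{0..<int n}. (if int (\<Prod>S) dvd k then 1 else 0) * unity_root n k) =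
        (- 1) ^ card S * (if \<Prod>S = n then 1 else 0)"
      by (simp only: sum_unity_root_multiples[OF assms])
  qed simp
  also have "\<dots> = of_int (moebius_mu n)"
    unfolding moebius_mu_eq_sum[OF assms] of_int_sum by (intro sum.cong) auto
  finally show ?thesis .
qed

lemma coprime_lift_mod:
  fixes r :: int
  assumes "n > 0" "d dvd n" "coprime r (int d)"
  shows "\<exists>k. coprime k (int n) \<and> [k = r] (mod int d)"
proof -
  \<comment> \<open>\<open>r + d t\<close> is prime to \<open>n\<close>, since each prime divisor of \<open>n\<close> divides exactly one of \<open>r\<close> and \<open>d t\<close>.\<close>
  define t where "t = \<Prod>{p \<in> prime_factors n. \<not> int p dvd r}"
  have t: "p dvd t \<longleftrightarrow> \<not> int p dvd r" if p: "p \<in> prime_factors n" for p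
  proof -
    have "p dvd t \<longleftrightarrow> (\<exists>q\<in>{p \<in> prime_factors n. \<not> int p dvd r}. p dvd q)"
      unfolding t_def using p by (intro prime_dvd_prod_iff) auto
    also have "\<dots> \<longleftrightarrow> \<not> int p dvd r"
      using p by (auto dest: primes_dvd_imp_eq[of p, rotated 2])
    finally show ?thesis .
  qed
  let ?k = "r + int d * int t"
  have "coprime ?k (int n)"
    unfolding coprime_int_iff_prime_factors[OF assms(1)]
  proof (intro ballI notI)
    fix p assume pP: "p \<in> prime_factors n" and pk: "int p dvd ?k"
    then have p: "prime p" by auto
    show False
    proof (cases "int p dvd r")
      case True
      then have "int p dvd int d * int t" using pk by (simp add: dvd_add_right_iff)
      then have "p dvd d * t" by (metis int_dvd_int_iff of_nat_mult)
      then have "p dvd d" using p t[OF pP] True by (simp add: prime_dvd_mult_iff)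
      then have "is_unit (int p)" using True assms(3) by (meson coprime_common_divisor int_dvd_int_iff)
      then show False using p by simp
    next
      case False
      then have "int p dvd int d * int t" using t[OF pP] by simp
      then show False using pk False by (simp add: dvd_add_left_iff)
    qed
  qed
  moreover have "[?k = r] (mod int d)" by (simp add: cong_def)
  ultimately show ?thesis by blast
qed

text \<open>The factor \<open>m\<close> is invertible modulo \<open>d\<close> but perhaps not modulo
  \<open>n\<close>, so multiplication by it need not permute \<open>units_mod n\<close>. It is
  replaced by a unit \<open>u\<close> modulo \<open>n\<close> with the same residue modulo
  \<open>d\<close>, which does permute them and has the same effect on \<open>d\<close>-th roots of
  unity.\<close>

lemma sum_units_mod_twist:
  assumes "n > 0" "d dvd n" "coprime m (int d)"
  shows "(\<Sum>k\<in>units_mod n. unity_root d (m * k)) = (\<Sum>k\<in>units_mod n. unity_root d k)"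
proof -
  have d: "d > 0" using assms by (auto intro: dvd_pos_nat)
  obtain u where u: "coprime u (int n)" "[u = m] (mod int d)"
    using coprime_lift_mod[OF assms] by blast
  \<comment> \<open>Multiplication by \<open>v\<close> modulo \<open>n\<close> is the inverse
    permutation, the other half of the reindexing.\<close>
  obtain v where v: "[u * v = 1] (mod int n)" using u(1) cong_solve_coprime_int by blast
  then have cv: "coprime v (int n)"
    by (metis coprime_iff_invertible_int mult.commute)
  have inv: "u * (v * k mod int n) mod int n = k" "v * (u * k mod int n) mod int n = k"
    if "k \<in> units_mod n" for k
  proof -
    have "[u * v * k = 1 * k] (mod int n)" using v by (intro cong_mult cong_refl)
    then show "u * (v * k mod int n) mod int n = k" "v * (u * k mod int n) mod int n = k"
      using that by (simp_all add: cong_def units_mod_def mod_simps ac_simps)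
  qed
  have cl: "w * k mod int n \<in> units_mod n" if "coprime w (int n)" "k \<in> units_mod n" for w k
  proof -
    have "coprime (w * k) (int n)" using that by (simp add: units_mod_def)
    then have "coprime (w * k mod int n) (int n)"
      using assms(1) by (subst coprime_mod_left_iff) simp_all
    then show ?thesis using assms(1) by (simp add: units_mod_def del: coprime_mod_left_iff)
  qed
  have key: "unity_root d (u * k mod int n) = unity_root d (m * k)" for k
  proof (rule unity_root_cong[OF d])
    have "[u * k mod int n = u * k] (mod int d)"
      by (rule cong_dvd_modulus[of _ _ "int n"]) (use assms(2) in \<open>simp_all add: cong_def\<close>)
    also have "[u * k = m * k] (mod int d)" using u(2) by (intro cong_mult cong_refl)
    finally show "[u * k mod int n = m * k] (mod int d)" .
  qed
  show ?thesis
    by (rule sum.reindex_bij_witness[of _ "\<lambda>k. v * k mod int n" "\<lambda>k. u * k mod int n"])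
      (simp_all only: inv cl u(1) cv key)
qed

theorem ramanujan_sum:
  fixes m :: int
  assumes "n > 0"
  and d_def: "d = n div nat (gcd m (int n))"
  shows "(\<Sum>k\<in>units_mod n. unity_root n (m * k)) = of_int (moebius_mu d) * of_nat (totient n) / of_nat (totient d)"
proof -
  define g where "g = nat (gcd m (int n))"
  have g: "int g = gcd m (int n)" "g > 0" using assms by (auto simp: g_def)
  have "int g dvd int n" unfolding g by simp
  then have n: "n = g * d" unfolding d_def g_def[symmetric] by simp
  then have d: "d > 0" "d dvd n" using assms(1) by (auto simp del: d_def intro: Nat.gr0I)
  obtain m' where m': "m = int g * m'" using g(1) by (metis gcd_dvd1 dvdE)
  have "int g * gcd m' (int d) = int g * 1"
    using g(1) unfolding m' n by (simp add: gcd_mult_distrib_int[symmetric])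
  then have cop: "coprime m' (int d)" using g(2) by (simp add: coprime_iff_gcd_eq_1)
  have "unity_root n (m * k) = unity_root d (m' * k)" for k
    using unity_root_mult_cancel[OF g(2), of d "m' * k"] by (simp add: n m' mult.assoc)
  then have eq: "(\<Sum>k\<in>units_mod n. unity_root n (m * k)) = (\<Sum>k\<in>units_mod n. unity_root d k)"
    using sum_units_mod_twist[OF assms(1) d(2) cop] by simp
  \<comment> \<open>Averaging over the twists by units modulo \<open>d\<close> avoids counting the fibres of the reduction map.\<close>
  have "of_nat (totient d) * (\<Sum>k\<in>units_mod n. unity_root d k) =
      (\<Sum>r\<in>units_mod d. \<Sum>k\<in>units_mod n. unity_root d (r * k))"
  proof -
    have "(\<Sum>k\<in>units_mod n. unity_root d (r * k)) = (\<Sum>k\<in>units_mod n. unity_root d k)"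
      if "r \<in> units_mod d" for r
      using that by (intro sum_units_mod_twist assms(1) d(2)) (simp add: units_mod_def)
    then show ?thesis by (simp add: card_units_mod)
  qed
  also have "\<dots> = (\<Sum>k\<in>units_mod n. \<Sum>r\<in>units_mod d. unity_root d (k * r))"
    by (subst sum.swap) (simp add: mult.commute)
  \<comment> \<open>After the exchange of sums \<open>k\<close> acts as the twist. It is a unit
    modulo \<open>d\<close>, so each inner sum is the sum of the primitive \<open>d\<close>-th roots
    of unity.\<close>
  also have "\<dots> = (\<Sum>k\<in>units_mod n. of_int (moebius_mu d))"
  proof (rule sum.cong)
    fix k assume "k \<in> units_mod n"
    then have "coprime k (int d)" using d(2)
      by (auto simp: units_mod_def intro: coprime_divisors[of k k "int d" "int n"])
    then show "(\<Sum>r\<in>units_mod d. unity_root d (k * r)) = of_int (moebius_mu d)"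
      using sum_units_mod_twist[OF d(1), of d k] sum_primitive_unity_roots[OF d(1)] by simp
  qed simp
  also have "\<dots> = of_nat (totient n) * of_int (moebius_mu d)" by (simp add: card_units_mod)
  finally show ?thesis using d(1) unfolding eq by (simp add: field_simps)
qed

section \<open>Divisors of the radical and the multiplicities they produce\<close>

text \<open>Explains the appearance of the radical: its divisors are exactly the divisors of
  \<open>n\<close> at which the Moebius function does not vanish.\<close>

lemma dvd_radical_iff:
  fixes n k :: nat
  assumes n: "n > 0"
  shows "k dvd \<Prod>{p. prime p \<and> p dvd n} \<longleftrightarrow> k dvd n \<and> squarefree k"
proof -
  let ?P = "{p. prime p \<and> p dvd n}"
  have P: "finite ?P" "\<And>p. p \<in> ?P \<Longrightarrow> prime p" using n by auto
  have P_dvd: "\<Prod>?P dvd n" using prod_primes_dvd_iff[OF P, of n] by auto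
  have sqf: "squarefree (\<Prod>?P)"
    by (rule squarefree_prod_coprime) (auto intro: primes_coprime squarefree_prime)
  show ?thesis
  proof
    assume "k dvd \<Prod>?P"
    then show "k dvd n \<and> squarefree k" using P_dvd sqf by (meson dvd_trans squarefree_mono)
  next
    assume k: "k dvd n \<and> squarefree k"
    then have "p dvd \<Prod>?P" if "p \<in> prime_factors k" for p
      using that P(1) by (intro dvd_prodI) (auto intro: dvd_trans)
    then have "\<Prod>(prime_factors k) dvd \<Prod>?P"
      by (subst prod_primes_dvd_iff) auto
    then show "k dvd \<Prod>?P" using prod_prime_factors_squarefree[of k] k by simp
  qed
qed

lemma replicate_mset_add: "replicate_mset (k + l) x = replicate_mset k x + replicate_mset l x"
  by (rule multiset_eqI) simp

lemma sum_replicate_mset_same: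
  "finite A \<Longrightarrow> (\<Sum>x\<in>A. replicate_mset (g x) c) = replicate_mset (\<Sum>x\<in>A. g x) c"
  by (induction A rule: finite_induct) (simp_all add: replicate_mset_add)

text \<open>The condition says \<open>gcd m n = n div d\<close>, whose solutions in
  \<open>{0<..n}\<close> are counted by the totient. Excluding \<open>d = 1\<close> is what removes
  \<open>m = n\<close> from that range.\<close>

lemma card_div_gcd_eq:
  assumes "n > 0" "d dvd n" "d \<noteq> 1"
  shows "card {m \<in> {1..<n}. n div gcd m n = d} = totient d"
proof -
  have div_div: "n div (n div g) = g" if "g dvd n" for g
    using that assms(1) by (auto elim!: dvdE)
  have "{m \<in> {1..<n}. n div gcd m n = d} = {k \<in> {0<..n}. gcd k n = n div d}"
  proof (intro equalityI subsetI)
    fix m assume "m \<in> {m \<in> {1..<n}. n div gcd m n = d}"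
    then have m: "1 \<le> m" "m < n" "n div gcd m n = d" by auto
    have "n div d = gcd m n" using div_div[of "gcd m n"] m(3) by simp
    then show "m \<in> {k \<in> {0<..n}. gcd k n = n div d}" using m by simp
  next
    fix m assume "m \<in> {k \<in> {0<..n}. gcd k n = n div d}"
    then have m: "0 < m" "m \<le> n" "gcd m n = n div d" by auto
    then have eq: "n div gcd m n = d" using div_div[OF assms(2)] by simp
    have "m \<noteq> n" using eq assms(1,3) by auto
    then show "m \<in> {m \<in> {1..<n}. n div gcd m n = d}" using m(1,2) eq by simp
  qed
  moreover have "n div d dvd n" using assms(2) by (metis dvd_div_mult_self dvd_triv_left)
  ultimately show ?thesis
    using card_gcd_eq_totient[OF assms(1), of "n div d"] div_div[OF assms(2)] by simp
qed

text \<open>The nonzero residues modulo \<open>n\<close> are grouped by their additive order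
  \<open>n div gcd m n\<close>.\<close>

lemma sum_mset_div_gcd:
  assumes "n > 0"
  shows "(\<Sum>m\<in>{1..<n}. {#h (n div gcd m n)#}) =
    (\<Sum>d\<in>{d. d dvd n} - {1}. replicate_mset (totient d) (h d))"
proof -
  have fin: "finite {d. d dvd n}" using assms by simp
  have "(\<Sum>m\<in>{1..<n}. {#h (n div gcd m n)#}) =
      (\<Sum>d\<in>{d. d dvd n} - {1}. \<Sum>m\<in>{m \<in> {1..<n}. n div gcd m n = d}. {#h (n div gcd m n)#})"
  proof (rule sum.group[symmetric])
    have "n div gcd m n \<noteq> 1" if "1 \<le> m" "m < n" for m
    proof
      assume "n div gcd m n = 1"
      then have "gcd m n = n" by (metis dvd_div_mult_self gcd_dvd2 mult_1)
      then have "n dvd m" by (metis gcd_dvd1)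
      then show False using that by (auto dest: dvd_imp_le)
    qed
    moreover have "n div gcd m n dvd n" for m by (metis dvd_div_mult_self dvd_triv_left gcd_dvd2)
    ultimately show "(\<lambda>m. n div gcd m n) ` {1..<n} \<subseteq> {d. d dvd n} - {1}" by auto
  qed (use fin in auto)
  also have "\<dots> = (\<Sum>d\<in>{d. d dvd n} - {1}. replicate_mset (totient d) (h d))"
  proof (intro sum.cong)
    fix d assume d: "d \<in> {d. d dvd n} - {1}"
    have "(\<Sum>m\<in>{m \<in> {1..<n}. n div gcd m n = d}. {#h (n div gcd m n)#}) =
        (\<Sum>m\<in>{m \<in> {1..<n}. n div gcd m n = d}. replicate_mset 1 (h d))"
      by (intro sum.cong) auto
    also have "\<dots> = replicate_mset (totient d) (h d)"
      using card_div_gcd_eq[OF assms, of d] d by (simp add: sum_replicate_mset_same del: replicate_mset_Suc One_nat_def)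
    finally show "(\<Sum>m\<in>{m \<in> {1..<n}. n div gcd m n = d}. {#h (n div gcd m n)#}) =
        replicate_mset (totient d) (h d)" .
  qed simp
  finally show ?thesis .
qed

section \<open>Ramanujan sums over residues modulo \<open>2 * n\<close>\<close>

text \<open>The residues run modulo \<open>2 * n\<close>, but coprimality is tested against
  \<open>n\<close>: for odd \<open>n\<close> even residues occur too. These are the exponents of the
  non-isolated rotations of the dicyclic group, and also the differences of adjacent
  reflections.\<close>

definition units_double :: "nat \<Rightarrow> int set" where
  "units_double n = {k \<in> {0..<int (2 * n)}. coprime k (int n)}"

lemma coprime_add_self_iff: "coprime (k + int n) (int n) \<longleftrightarrow> coprime k (int n)"
  by (simp add: coprime_iff_gcd_eq_1 gcd_add1)

lemma sum_units_double:
  "(\<Sum>k\<in>units_double n. h k) = (\<Sum>k\<in>units_mod n. h k + h (k + int n) :: 'a :: comm_monoid_add)"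
proof -
  have "units_double n = units_mod n \<union> (\<lambda>k. k + int n) ` units_mod n"
  proof (intro equalityI subsetI)
    fix k assume k: "k \<in> units_double n"
    show "k \<in> units_mod n \<union> (\<lambda>k. k + int n) ` units_mod n"
    proof (cases "k < int n")
      case True
      then show ?thesis using k by (simp add: units_double_def units_mod_def)
    next
      case False
      then have "k - int n \<in> units_mod n" 
        using k coprime_add_self_iff[of "k - int n" n] by (simp add: units_double_def units_mod_def)
      then show ?thesis by (intro UnI2 image_eqI[of _ _ "k - int n"]) simp_all
    qed
  next
    fix k assume "k \<in> units_mod n \<union> (\<lambda>k. k + int n) ` units_mod n"
    then show "k \<in> units_double n"
      by (auto simp: units_mod_def units_double_def coprime_add_self_iff)
  qed
  moreover have "units_mod n \<inter> (\<lambda>k. k + int n) ` units_mod n = {}" by (auto simp: units_mod_def)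
  ultimately have "(\<Sum>k\<in>units_double n. h k) =
      (\<Sum>k\<in>units_mod n. h k) + (\<Sum>k\<in>(\<lambda>k. k + int n) ` units_mod n. h k)"
    by (simp add: sum.union_disjoint)
  then show ?thesis by (simp add: sum.reindex sum.distrib)
qed

lemma finite_units_double [simp]: "finite (units_double n)"
  unfolding units_double_def by (rule finite_subset[of _ "{0..<int (2 * n)}"]) auto

lemma card_units_double: "card (units_double n) = 2 * totient n"
  using sum_units_double[of "\<lambda>_. 1 :: nat" n] by (simp add: card_units_mod)

text \<open>The \<open>m\<close>-th adjacency eigenvalue of the circulant graph on Z/2n with
  connection set \<open>units_double n\<close>.\<close>

definition double_ramanujan :: "nat \<Rightarrow> nat \<Rightarrow> complex" where
  "double_ramanujan n m = (\<Sum>k\<in>units_double n. unity_root (2 * n) (int m * k))"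

text \<open>Shifting \<open>k\<close> by \<open>n\<close> multiplies the \<open>m\<close>-th
  character modulo \<open>2 * n\<close> by the sign \<open>unity_root 2 (int m)\<close>. The last
  factor is therefore 2 or 0 according to the parity of \<open>m\<close>.\<close>

lemma double_ramanujan_eq:
  assumes "n > 0"
  shows "double_ramanujan n m =
    (\<Sum>k\<in>units_mod n. unity_root (2 * n) (int m * k)) * (1 + unity_root 2 (int m))"
proof -
  have "unity_root (2 * n) (int m * (k + int n)) = unity_root (2 * n) (int m * k) * unity_root 2 (int m)" for k
    using unity_root_mult_cancel[OF assms, of 2 "int m"]
    by (simp add: distrib_left unity_root_add mult.commute)
  then show ?thesis
    by (simp add: double_ramanujan_def sum_units_double sum_distrib_right distrib_left sum.distrib)
qed

lemma double_ramanujan_odd: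
  assumes "n > 0"
  shows "double_ramanujan n (2 * m + 1) = 0"
proof -
  have "unity_root 2 (int (2 * m + 1)) = unity_root 2 1"
    by (rule unity_root_cong) (auto simp: cong_def)
  also have "\<dots> = - 1" by (simp add: unity_root_def)
  finally have "1 + unity_root 2 (int (2 * m + 1)) = 0" by simp
  then show ?thesis by (simp only: double_ramanujan_eq[OF assms] mult_zero_right)
qed

lemma double_ramanujan_even:
  assumes "n > 0"
  shows "double_ramanujan n (2 * m) =
    2 * of_int (moebius_mu (n div gcd m n)) * of_nat (totient n) / of_nat (totient (n div gcd m n))"
proof -
  have "unity_root 2 (int (2 * m)) = 1" by (simp add: unity_root_eq_1_iff)
  moreover have "unity_root (2 * n) (int (2 * m) * k) = unity_root n (int m * k)" for k
    using unity_root_mult_cancel[of 2 n "int m * k"] by (simp add: mult.assoc)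
  ultimately have "double_ramanujan n (2 * m) = (\<Sum>k\<in>units_mod n. unity_root n (int m * k)) * 2"
    by (simp only: double_ramanujan_eq[OF assms] one_add_one)
  also have "\<dots> = 2 * of_int (moebius_mu (n div gcd m n)) * of_nat (totient n) / of_nat (totient (n div gcd m n))"
    by (simp add: ramanujan_sum[OF assms HOL.refl])
  finally show ?thesis .
qed

text \<open>Odd \<open>m\<close> contribute \<open>n\<close> copies of \<open>c\<close>. Even
  indices are grouped by \<open>k = n div gcd m n\<close>; where \<open>k\<close> is not squarefree
  the Moebius value is 0 and the result is again \<open>c\<close>. Since \<open>m = 0\<close> is
  absent, \<open>k = 1\<close> is absent too, so the sum over divisors starts at index 2.\<close>

lemma mset_double_ramanujan:
  fixes n n0 t :: nat and d :: "nat \<Rightarrow> nat" and c :: complex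
  assumes n: "n > 0"
    and n0: "n0 = \<Prod>{p. prime p \<and> p dvd n}"
    and t: "t = card {k. k dvd n0}"
    and d: "strict_mono_on {1..t} d" "d ` {1..t} = {k. k dvd n0}"
  shows "(\<Sum>m\<in>{1..<2 * n}. {#c - double_ramanujan n m#}) =
    (\<Sum>i\<in>{2..t}. replicate_mset (totient (d i))
      (c - 2 * of_int (moebius_mu (d i)) * of_nat (totient n) / of_nat (totient (d i))))
    + replicate_mset (2 * n - n0) c"
proof -
  define h where "h k = c - 2 * of_int (moebius_mu k) * of_nat (totient n) / of_nat (totient k)" for k
  have n0_dvd: "k dvd n0 \<longleftrightarrow> k dvd n \<and> squarefree k" for k
    unfolding n0 using n by (rule dvd_radical_iff)
  then have n0n: "n0 dvd n" using dvd_refl by metis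
  then have n0_pos: "n0 > 0" using n by (auto intro: Nat.gr0I)
  have fin: "finite {k. k dvd n}" "finite {k. k dvd n0}" using n n0_pos by simp_all
  have "{1..<2 * n} = (\<lambda>m. 2 * m) ` {1..<n} \<union> (\<lambda>m. 2 * m + 1) ` {0..<n}"
  proof (intro equalityI subsetI)
    fix m assume m: "m \<in> {1..<2 * n}"
    show "m \<in> (\<lambda>m. 2 * m) ` {1..<n} \<union> (\<lambda>m. 2 * m + 1) ` {0..<n}"
    proof (cases "even m")
      case True
      then show ?thesis using m by (auto elim!: evenE)
    next
      case False
      then obtain k where "m = 2 * k + 1" by (elim oddE)
      then show ?thesis using m by (intro UnI2 image_eqI[of _ _ k]) auto
    qed
  qed auto
  moreover have "(\<lambda>m. 2 * m) ` {1..<n} \<inter> (\<lambda>m. 2 * m + 1) ` {0..<n} = {}" by (auto; presburger)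
  ultimately have "(\<Sum>m\<in>{1..<2 * n}. {#c - double_ramanujan n m#}) =
      (\<Sum>m\<in>(\<lambda>m. 2 * m) ` {1..<n}. {#c - double_ramanujan n m#})
      + (\<Sum>m\<in>(\<lambda>m. 2 * m + 1) ` {0..<n}. {#c - double_ramanujan n m#})"
    by (simp only: sum.union_disjoint finite_imageI finite_atLeastLessThan)
  also have "(\<Sum>m\<in>(\<lambda>m. 2 * m) ` {1..<n}. {#c - double_ramanujan n m#}) =
      (\<Sum>m\<in>{1..<n}. {#h (n div gcd m n)#})"
    by (subst sum.reindex) (auto simp: inj_on_def double_ramanujan_even[OF n] h_def)
  also have "\<dots> = (\<Sum>k\<in>{k. k dvd n} - {1}. replicate_mset (totient k) (h k))"
    using n by (rule sum_mset_div_gcd)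
  also have "\<dots> = (\<Sum>k\<in>{k. k dvd n0} - {1}. replicate_mset (totient k) (h k))
      + (\<Sum>k\<in>{k. k dvd n} - {k. k dvd n0}. replicate_mset (totient k) (h k))"
  proof -
    have "{k. k dvd n} - {1} = ({k. k dvd n0} - {1}) \<union> ({k. k dvd n} - {k. k dvd n0})"
      using n0n by (auto intro: dvd_trans)
    then show ?thesis using fin by (simp only:) (subst sum.union_disjoint; auto)
  qed
  also have "(\<Sum>k\<in>{k. k dvd n} - {k. k dvd n0}. replicate_mset (totient k) (h k)) =
      (\<Sum>k\<in>{k. k dvd n} - {k. k dvd n0}. replicate_mset (totient k) c)"
    by (intro sum.cong) (auto simp: n0_dvd h_def moebius_mu_def)
  also have "\<dots> = replicate_mset (n - n0) c"
  proof -
    \<comment> \<open>Totients over all divisors of a number sum to that number; this is applied to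
      \<open>n\<close> and to \<open>n0\<close>.\<close>
    have "(\<Sum>k\<in>{k. k dvd n} - {k. k dvd n0}. totient k) = n - n0"
      using fin n0n by (subst sum_diff_nat) (auto simp: totient_divisor_sum intro: dvd_trans)
    then show ?thesis using fin by (simp add: sum_replicate_mset_same)
  qed
  also have "(\<Sum>k\<in>{k. k dvd n0} - {1}. replicate_mset (totient k) (h k)) =
      (\<Sum>i\<in>{2..t}. replicate_mset (totient (d i)) (h (d i)))"
  proof -
    have inj: "inj_on d {1..t}" using d(1) by (rule strict_mono_on_imp_inj_on)
    obtain i where i: "i \<in> {1..t}" "d i = 1" using d(2) by (metis (mono_tags) image_iff mem_Collect_eq one_dvd)
    \<comment> \<open>If 1 were the value at a later index, monotonicity would force
      \<open>d 1 = 0\<close>, and 0 does not divide \<open>n0\<close>.\<close>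
    have "d 1 = 1"
    proof (rule ccontr)
      assume "d 1 \<noteq> 1"
      then have "1 < i" using i by (cases "i = 1") auto
      then have "d 1 < d i" using i(1) by (intro strict_mono_onD[OF d(1)]) auto
      moreover have "d 1 \<in> d ` {1..t}" using i(1) by auto
      ultimately have "0 dvd n0" using d(2) i(2) by auto
      then show False using n0_pos by simp
    qed
    moreover have "d ` ({1..t} - {1}) = d ` {1..t} - d ` {1}"
      by (rule inj_on_image_set_diff[OF inj]) (use i in auto)
    moreover have "{1..t} - {1} = {2..t}" by auto
    ultimately have eq: "{k. k dvd n0} - {1} = d ` {2..t}" by (simp only: d(2) image_insert image_empty)
    have "inj_on d {2..t}" using inj by (rule inj_on_subset) auto
    then show ?thesis unfolding eq by (simp add: sum.reindex)
  qed
  also have "(\<Sum>m\<in>(\<lambda>m. 2 * m + 1) ` {0..<n}. {#c - double_ramanujan n m#}) = replicate_mset n c"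
  proof -
    have "(\<Sum>m\<in>(\<lambda>m. 2 * m + 1) ` {0..<n}. {#c - double_ramanujan n m#}) = (\<Sum>m\<in>{0..<n}. replicate_mset 1 c)"
      by (subst sum.reindex) (auto simp: inj_on_def double_ramanujan_odd[OF n, simplified])
    then show ?thesis by (simp add: sum_replicate_mset_same del: replicate_mset_Suc One_nat_def)
  qed
  finally have "(\<Sum>m\<in>{1..<2 * n}. {#c - double_ramanujan n m#}) =
      (\<Sum>i\<in>{2..t}. replicate_mset (totient (d i)) (h (d i))) + replicate_mset (n - n0 + n) c"
    by (simp only: replicate_mset_add add.assoc)
  \<comment> \<open>Subtraction is truncated here, so the identity relies on
    \<open>n0 \<le> n\<close>.\<close>
  moreover have "n - n0 + n = 2 * n - n0" using dvd_imp_le[OF n0n n] by simp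
  ultimately show ?thesis by (simp only: h_def)
qed

section \<open>Generating pairs in dihedral and dicyclic groups\<close>

text \<open>Here \<open>N = 2 n\<close>, \<open>m = n\<close> gives the dicyclic group, \<open>N = n\<close>, \<open>m = 0\<close> the dihedral group.\<close>

locale dihedral_like = group G for G :: "('g, 'b) monoid_scheme" (structure) +
  fixes a b :: 'g and N m n :: nat
  assumes a_closed [simp]: "a \<in> carrier G" and b_closed [simp]: "b \<in> carrier G"
    and pow_a: "a [^] N = \<one>" and b_square: "b \<otimes> b = a [^] m" and b_a: "b \<otimes> a = inv a \<otimes> b"
    and spans: "\<And>x. x \<in> carrier G \<Longrightarrow> \<exists>i<N. \<exists>e. x = a [^] (i::nat) \<otimes> (if e then b else \<one>)"
    and order: "Coset.order G = 2 * N"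
    and gcd_N_m: "gcd N m = n" and m_dvd: "N dvd 2 * m"
    and n_ge_2: "n \<ge> 2" and N_pos: "N > 0"
begin

definition el :: "int \<times> bool \<Rightarrow> 'g" where
  "el v = a [^] fst v \<otimes> (if snd v then b else \<one>)"

lemma el_closed [simp]: "el v \<in> carrier G"
  by (simp add: el_def)

lemma b_pow_a: "b \<otimes> a [^] (k::int) = a [^] (- k) \<otimes> b"
proof -
  have nat: "b \<otimes> a [^] i = a [^] (- int i) \<otimes> b" for i :: nat
  proof (induction i)
    case (Suc i)
    have "b \<otimes> a [^] Suc i = (b \<otimes> a [^] i) \<otimes> a" by (simp add: m_assoc)
    also have "\<dots> = a [^] (- int i) \<otimes> (b \<otimes> a)" by (simp add: Suc m_assoc)
    also have "\<dots> = (a [^] (- int i) \<otimes> a [^] (- 1 :: int)) \<otimes> b"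
      by (simp add: b_a m_assoc int_pow_neg)
    also have "\<dots> = a [^] (- int (Suc i)) \<otimes> b" by (simp add: int_pow_mult[symmetric] add.commute)
    finally show ?case .
  qed simp
  have cancel: "a [^] (l::int) \<otimes> a [^] (- l) = \<one>" for l
    by (metis a_closed add.right_inverse int_pow_0 int_pow_mult)
  show ?thesis
  proof (cases k rule: int_cases2)
    case (nonneg i)
    then show ?thesis using nat[of i] by (simp only: int_pow_int)
  next
    case (nonpos i)
    \<comment> \<open>For negative exponents the case already proved is solved for \<open>b\<close>
      and then multiplied on the right by \<open>a [^] (- int i)\<close>.\<close>
    have "b = a [^] int i \<otimes> a [^] (- int i) \<otimes> b" by (simp only: cancel l_one b_closed)
    also have "\<dots> = a [^] int i \<otimes> (b \<otimes> a [^] int i)"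
      using nat[of i] by (metis m_assoc int_pow_closed a_closed b_closed int_pow_int)
    finally have "b \<otimes> a [^] (- int i) = a [^] int i \<otimes> (b \<otimes> a [^] int i) \<otimes> a [^] (- int i)"
      by (rule arg_cong)
    also have "\<dots> = a [^] int i \<otimes> (b \<otimes> (a [^] int i \<otimes> a [^] (- int i)))"
      by (simp only: m_assoc int_pow_closed a_closed b_closed m_closed)
    also have "\<dots> = a [^] int i \<otimes> b" by (simp only: cancel r_one b_closed)
    finally show ?thesis by (simp add: nonpos)
  qed
qed

lemma el_mult:
  "el (k, e) \<otimes> el (l, f) = el (k + (if e then - l else l) + (if e \<and> f then int m else 0), e \<noteq> f)"
proof (cases e)
  case False
  then show ?thesis by (simp add: el_def int_pow_mult m_assoc)
next
  case True
  have "el (k, e) \<otimes> el (l, f) = a [^] k \<otimes> (b \<otimes> a [^] l) \<otimes> (if f then b else \<one>)"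
    using True by (simp add: el_def m_assoc)
  also have "\<dots> = a [^] (k - l) \<otimes> (b \<otimes> (if f then b else \<one>))"
    by (simp add: b_pow_a m_assoc int_pow_mult[symmetric] flip: int_pow_mult)
       (simp add: m_assoc[symmetric] int_pow_mult[symmetric])
  finally show ?thesis
    using True by (auto simp: el_def b_square int_pow_mult int_pow_int)
qed

lemma one_eq_el: "\<one> = el (0, False)"
  by (simp add: el_def)

lemma el_cong:
  assumes "[k = l] (mod int N)"
  shows "el (k, e) = el (l, e)"
proof -
  obtain q where q: "k = l + int N * q" using assms by (metis cong_iff_lin cong_sym)
  have "a [^] (int N * q) = \<one>"
    by (metis a_closed int_pow_int int_pow_one int_pow_pow pow_a)
  then show ?thesis by (simp add: el_def q int_pow_mult)
qed

definition coords :: "(int \<times> bool) set" where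
  "coords = {0..<int N} \<times> UNIV"

lemma finite_coords [simp]: "finite coords"
  by (simp add: coords_def)

lemma card_coords: "card coords = 2 * N"
  by (simp add: coords_def card_cartesian_product)

lemma el_image: "el ` coords = carrier G"
proof
  show "carrier G \<subseteq> el ` coords"
  proof
    fix x assume "x \<in> carrier G"
    then obtain i e where "i < N" "x = a [^] i \<otimes> (if e then b else \<one>)" using spans by blast
    then have "x = el (int i, e)" "(int i, e) \<in> coords"
      by (auto simp: el_def coords_def int_pow_int)
    then show "x \<in> el ` coords" by blast
  qed
qed auto

text \<open>Normal forms are known to exhaust the group; uniqueness comes from counting, as there
  are exactly \<open>2 * N\<close> of them and the group has that order.\<close>

lemma el_bij: "bij_betw el coords (carrier G)"
proof -
  have "card (el ` coords) = card coords"
    using order by (simp add: el_image card_coords Coset.order_def)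
  then show ?thesis by (simp add: bij_betw_def el_image eq_card_imp_inj_on)
qed

lemma el_eq_iff: "el (k, e) = el (l, f) \<longleftrightarrow> e = f \<and> [k = l] (mod int N)"
proof
  assume eq: "el (k, e) = el (l, f)"
  have "el (k, e) = el (k mod int N, e)" "el (l, f) = el (l mod int N, f)"
    by (auto intro!: el_cong simp: cong_def)
  then have "el (k mod int N, e) = el (l mod int N, f)" using eq by simp
  moreover have "(k mod int N, e) \<in> coords" "(l mod int N, f) \<in> coords"
    using N_pos by (auto simp: coords_def)
  ultimately have "(k mod int N, e) = (l mod int N, f)"
    using el_bij unfolding bij_betw_def inj_on_def by blast
  then show "e = f \<and> [k = l] (mod int N)" by (simp add: cong_def)
qed (auto intro: el_cong)

text \<open>The inverse of a reflection \<open>x\<close> is \<open>a [^] m \<otimes> x\<close>: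
  since \<open>x\<close> squares to \<open>a [^] m\<close>, the product with \<open>x\<close> is
  \<open>a [^] (2 * m)\<close>, which is trivial by \<open>m_dvd\<close>.\<close>

lemma inv_el: "inv (el (k, e)) = el (if e then k + int m else - k, e)"
proof (rule inv_equality)
  show "el (if e then k + int m else - k, e) \<otimes> el (k, e) = \<one>"
    using m_dvd unfolding one_eq_el
    by (auto simp: el_mult el_eq_iff cong_0_iff int_dvd_int_iff[symmetric] simp del: int_dvd_int_iff)
qed auto

lemma carrier_cases:
  assumes "x \<in> carrier G"
  obtains k e where "x = el (k, e)"
  using assms unfolding el_image[symmetric] by auto

lemma n_dvd: "n dvd N" "n dvd m"
  using gcd_N_m by (metis gcd_dvd1, metis gcd_dvd2)

text \<open>With \<open>d = gcd i n\<close>, divisibility of exponents by \<open>d\<close> survives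
  reduction modulo \<open>N\<close> and the extra \<open>m\<close> from products of reflections, so
  only multiples of \<open>d\<close> occur among the generated rotations. Conversely the square of
  the reflection supplies \<open>a [^] m\<close>, and \<open>i\<close>, \<open>m\<close>,
  \<open>N\<close> together have greatest common divisor \<open>gcd i n\<close>.\<close>

lemma generate_rotation_reflection:
  "generate G {el (i, False), el (j, True)} = carrier G \<longleftrightarrow> coprime i (int n)"
proof
  let ?H = "generate G {el (i, False), el (j, True)}"
  have H: "subgroup ?H G" by (rule generate_is_subgroup) simp
  {
    assume gen: "?H = carrier G"
    define d where "d = gcd i (int n)"
    have d: "d dvd i" "d dvd int n" by (auto simp: d_def)
    then have dN: "d dvd int N" "d dvd int m"
      using n_dvd by (meson dvd_trans int_dvd_int_iff)+
    \<comment> \<open>\<open>S\<close> is the subgroup generated by \<open>a\<^sup>d\<close> and \<open>a\<^sup>j b\<close>.\<close>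
    define S where "S = {x. \<exists>k e. x = el (k, e) \<and> d dvd (if e then k - j else k)}"
    have "subgroup S G"
    proof (rule subgroupI)
      show "S \<subseteq> carrier G" by (auto simp: S_def)
      have "el (0, False) \<in> S" by (fastforce simp: S_def)
      then show "S \<noteq> {}" by blast
    next
      fix x assume "x \<in> S"
      then obtain k e where x: "x = el (k, e)" "d dvd (if e then k - j else k)" by (auto simp: S_def)
      have "d dvd (if e then (if e then k + int m else - k) - j else (if e then k + int m else - k))"
        using x(2) dN(2) by (auto simp: algebra_simps dest: dvd_add[of d "k - j" "int m"])
      then show "inv x \<in> S" unfolding x(1) inv_el S_def by blast
    next
      fix x y assume "x \<in> S" "y \<in> S"
      then obtain k e l f where x: "x = el (k, e)" "d dvd (if e then k - j else k)"
        and y: "y = el (l, f)" "d dvd (if f then l - j else l)" by (auto simp: S_def)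
      let ?r = "k + (if e then - l else l) + (if e \<and> f then int m else 0)"
      have "d dvd (if e \<noteq> f then ?r - j else ?r)"
      proof (cases e; cases f)
        assume "e" "f"
        then have "d dvd k - j" "d dvd l - j" using x(2) y(2) by auto
        then have "d dvd (k - j) - (l - j) + int m" using dN(2) by (blast intro: dvd_add dvd_diff)
        then show ?thesis using \<open>e\<close> \<open>f\<close> by simp
      next
        assume "e" "\<not> f"
        then have "d dvd k - j" "d dvd l" using x(2) y(2) by auto
        then have "d dvd (k - j) - l" by (rule dvd_diff)
        then show ?thesis using \<open>e\<close> \<open>\<not> f\<close> by (simp add: algebra_simps)
      next
        assume "\<not> e" "f"
        then have "d dvd k" "d dvd l - j" using x(2) y(2) by auto
        then have "d dvd k + (l - j)" by (rule dvd_add)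
        then show ?thesis using \<open>\<not> e\<close> \<open>f\<close> by (simp add: algebra_simps)
      qed (use x y in auto)
      then show "x \<otimes> y \<in> S" unfolding x(1) y(1) el_mult S_def by blast
    qed
    moreover have "{el (i, False), el (j, True)} \<subseteq> S"
      unfolding S_def using d by fastforce
    ultimately have "?H \<subseteq> S" by (simp add: generate_subgroup_incl)
    then have "el (1, False) \<in> S" using gen by auto
    then obtain k where "[1 = k] (mod int N)" "d dvd k" by (auto simp: S_def el_eq_iff)
    \<comment> \<open>Equality of elements fixes the exponent only modulo \<open>N\<close>, which
      suffices because \<open>d\<close> divides \<open>N\<close>.\<close>
    then have "d dvd 1" using dN(1) by (metis cong_dvd_iff cong_dvd_modulus)
    then have "is_unit (gcd i (int n))" by (simp add: d_def)
    then show "coprime i (int n)" by (simp add: coprime_iff_gcd_eq_1)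
  }
  {
    assume cop: "coprime i (int n)"
    have i: "el (i, False) \<in> ?H" and j: "el (j, True) \<in> ?H" by (auto intro: generate.incl)
    have "el (j, True) \<otimes> el (j, True) \<in> ?H" using j H by (simp add: subgroup.m_closed)
    then have m: "el (int m, False) \<in> ?H" by (simp add: el_mult)
    have pow: "el (k * l, False) \<in> ?H" if "el (k, False) \<in> ?H" for k l
    proof -
      have "el (k, False) [^] l \<in> ?H" using subgroup_int_pow_closed[OF H that] .
      then show ?thesis by (simp add: el_def int_pow_pow)
    qed
    have rot: "el (k, False) \<in> ?H" for k
    proof -
      \<comment> \<open>Bezout is used twice: 1 is combined from \<open>i\<close> and
        \<open>n\<close>, and \<open>n\<close> from \<open>N\<close> and \<open>m\<close>. The
        multiple of \<open>N\<close> then disappears by periodicity.\<close>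
      obtain u v where uv: "i * u + int n * v = 1"
        using cop bezout_int[of i "int n"] by (metis coprime_iff_gcd_eq_1 mult.commute)
      obtain s t where st: "int N * s + int m * t = int n"
        using bezout_int[of "int N" "int m"] gcd_N_m by (metis gcd_int_int_eq mult.commute)
      have "k = (i * u + (int N * s + int m * t) * v) * k" by (simp add: uv st)
      then have "k = i * (u * k) + int m * (t * v * k) + int N * (s * v * k)" by (simp add: algebra_simps)
      then have "[k = i * (u * k) + int m * (t * v * k)] (mod int N)"
        by (metis cong_add_lcancel_0 cong_mult_self_left)
      then have "el (k, False) = el (i * (u * k), False) \<otimes> el (int m * (t * v * k), False)"
        by (simp add: el_mult el_eq_iff)
      then show ?thesis using pow[OF i] pow[OF m] H by (simp add: subgroup.m_closed)
    qed
    have refl: "el (k, True) \<in> ?H" for k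
    proof -
      have "el (k, True) = el (k - j, False) \<otimes> el (j, True)" by (simp add: el_mult)
      then show ?thesis using rot j H by (simp add: subgroup.m_closed)
    qed
    have "carrier G \<subseteq> ?H"
    proof
      fix x assume "x \<in> carrier G"
      then obtain k e where "x = el (k, e)" by (rule carrier_cases)
      then show "x \<in> ?H" using rot refl by (cases e) auto
    qed
    then show "?H = carrier G" using subgroup.subset[OF H] by blast
  }
qed

text \<open>The quotient of two reflections is a rotation, which reduces this pair to the mixed
  case.\<close>

lemma generate_reflections:
  "generate G {el (i, True), el (j, True)} = generate G {el (i - j, False), el (j, True)}"
proof -
  have sub: "generate G {x, y} \<subseteq> generate G {u, v}"
    if "x \<in> generate G {u, v}" "y \<in> generate G {u, v}" "u \<in> carrier G" "v \<in> carrier G" for x y u v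
    using that by (intro generate_subgroup_incl generate_is_subgroup) auto
  have H: "subgroup (generate G {el u, el v}) G" for u v
    by (rule generate_is_subgroup) simp
  have "el (i, True) \<otimes> inv (el (j, True)) \<in> generate G {el (i, True), el (j, True)}"
    by (intro subgroup.m_closed[OF H] subgroup.m_inv_closed[OF H] generate.incl) auto
  moreover have "el (i, True) \<otimes> inv (el (j, True)) = el (i - j, False)"
    by (simp add: inv_el el_mult)
  ultimately have 1: "el (i - j, False) \<in> generate G {el (i, True), el (j, True)}" by simp
  have "el (i - j, False) \<otimes> el (j, True) \<in> generate G {el (i - j, False), el (j, True)}"
    by (intro subgroup.m_closed[OF H] generate.incl) auto
  then have 2: "el (i, True) \<in> generate G {el (i - j, False), el (j, True)}" by (simp add: el_mult)
  show ?thesis using 1 2 by (intro equalityI sub) (auto intro: generate.incl)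
qed

lemma generate_rotations:
  "generate G {el (i, False), el (j, False)} \<noteq> carrier G"
proof
  assume gen: "generate G {el (i, False), el (j, False)} = carrier G"
  define S where "S = range (\<lambda>k. el (k, False))"
  have "subgroup S G"
    by (rule subgroupI) (auto simp: S_def inv_el el_mult)
  then have "generate G {el (i, False), el (j, False)} \<subseteq> S"
    by (intro generate_subgroup_incl) (auto simp: S_def)
  then have "el (0, True) \<in> S" using gen by auto
  then show False by (auto simp: S_def el_eq_iff)
qed

end

text \<open>A pair \<open>(k, e)\<close> stands for \<open>a\<^sup>k b\<^sup>e\<close>.\<close>

definition adj :: "nat \<Rightarrow> int \<times> bool \<Rightarrow> int \<times> bool \<Rightarrow> bool" where
  "adj n u v \<longleftrightarrow>
    (if snd u then coprime (if snd v then fst u - fst v else fst v) (int n)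
     else snd v \<and> coprime (fst u) (int n))"

text \<open>The relation \<open>adj\<close> has no clause for distinctness. Two rotations are never
  adjacent, and equal reflections have a difference divisible by \<open>n\<close>, which is not
  coprime to \<open>n\<close> because \<open>n \<ge> 2\<close>.\<close>

lemma (in dihedral_like) parcs_generating_graph:
  "(el u, el v) \<in> parcs (generating_graph G) \<longleftrightarrow> adj n u v"
proof -
  obtain i e j f where uv: "u = (i, e)" "v = (j, f)" by (cases u; cases v)
  have "generate G {el u, el v} = carrier G \<longleftrightarrow> adj n u v"
    using generate_rotation_reflection[of j i] generate_rotation_reflection[of i j]
      generate_rotation_reflection[of "i - j" j] generate_reflections[of i j] generate_rotations[of i j]
    by (cases e; cases f) (simp_all add: uv adj_def insert_commute)
  moreover have "el u \<noteq> el v" if "adj n u v"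
  proof
    assume "el u = el v"
    then have "e = f" "[i = j] (mod int N)" by (simp_all add: uv el_eq_iff)
    then have "e" "coprime (i - j) (int n)" "int n dvd i - j"
      using that n_dvd(1) by (auto simp: uv adj_def cong_iff_dvd_diff split: if_splits intro: dvd_trans)
    then have "is_unit (int n)" by (meson coprime_common_divisor dvd_refl)
    then show False using n_ge_2 by simp
  qed
  ultimately show ?thesis by (auto simp: generating_graph_def)
qed

section \<open>The presented groups as instances of the locale\<close>

lemma class_replicate:
  "word_class R (replicate i (Gen x)) = word_class R [Gen x] [^]\<^bsub>presented_group R\<^esub> i"
proof (induction i)
  case 0
  interpret group "presented_group R" by (rule group_presented_group)
  show ?case by (simp add: one_presented_group)
next
  case (Suc i)
  interpret group "presented_group R" by (rule group_presented_group)
  have "word_class R (replicate (Suc i) (Gen x)) = word_class R (replicate i (Gen x) @ [Gen x])"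
    by (simp add: replicate_append_same)
  then show ?case by (simp add: Suc flip: mult_presented_group)
qed

lemma dihedral_like_presented_group:
  assumes N: "N > 0" and aN: "word_eq R (replicate N (Gen gen_a)) []"
    and bb: "word_eq R [Gen gen_b, Gen gen_b] (replicate m (Gen gen_a))"
    and ba: "word_eq R [Gen gen_b, Gen gen_a] [Inv gen_a, Gen gen_b]"
    and order: "Coset.order (presented_group R) = 2 * N"
    and "gcd N m = n" "N dvd 2 * m" "n \<ge> 2"
  shows "dihedral_like (presented_group R) (word_class R [Gen gen_a]) (word_class R [Gen gen_b]) N m n"
proof -
  let ?G = "presented_group R" and ?a = "word_class R [Gen gen_a]" and ?b = "word_class R [Gen gen_b]"
  interpret group ?G by (rule group_presented_group)
  have cl: "word_class R w \<in> carrier ?G" for w by (simp add: carrier_presented_group)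
  have "word_class R [Inv gen_a] \<otimes>\<^bsub>?G\<^esub> ?a = \<one>\<^bsub>?G\<^esub>"
    using word_eq.cancel_Inv_Gen[of R "[]" gen_a "[]"]
    by (simp add: mult_presented_group one_presented_group word_class_eq_iff)
  then have inv_a: "inv\<^bsub>?G\<^esub> ?a = word_class R [Inv gen_a]" by (intro inv_equality cl)
  show ?thesis
  proof (unfold_locales)
    show "?a [^]\<^bsub>?G\<^esub> N = \<one>\<^bsub>?G\<^esub>" using aN
      by (simp add: class_replicate[symmetric] one_presented_group word_class_eq_iff)
    show "?b \<otimes>\<^bsub>?G\<^esub> ?b = ?a [^]\<^bsub>?G\<^esub> m" using bb
      by (simp add: class_replicate[symmetric] mult_presented_group word_class_eq_iff)
    show "?b \<otimes>\<^bsub>?G\<^esub> ?a = inv\<^bsub>?G\<^esub> ?a \<otimes>\<^bsub>?G\<^esub> ?b" using ba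
      by (simp add: inv_a mult_presented_group word_class_eq_iff)
    fix x assume "x \<in> carrier ?G"
    then obtain u where u: "x = word_class R u" by (auto simp: carrier_presented_group)
    obtain i e where i: "i < N" and "word_eq R u (replicate i (Gen gen_a) @ (if e then [Gen gen_b] else []))"
      using word_eq_normal_form[OF N aN bb ba] by blast
    then have "x = word_class R (replicate i (Gen gen_a)) \<otimes>\<^bsub>?G\<^esub> word_class R (if e then [Gen gen_b] else [])"
      by (simp add: u mult_presented_group word_class_eq_iff)
    then have "x = ?a [^]\<^bsub>?G\<^esub> i \<otimes>\<^bsub>?G\<^esub> (if e then ?b else \<one>\<^bsub>?G\<^esub>)"
      by (simp add: class_replicate one_presented_group)
    then show "\<exists>i<N. \<exists>e. x = ?a [^]\<^bsub>?G\<^esub> i \<otimes>\<^bsub>?G\<^esub> (if e then ?b else \<one>\<^bsub>?G\<^esub>)"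
      using i by blast
  qed (use assms cl in auto)
qed

lemma word_eq_relation: "(r, s) \<in> R \<Longrightarrow> word_eq R r s"
  using word_eq.relation[of r s R "[]" "[]"] by simp

lemma dihedral_like_dicyclic_group:
  assumes "n \<ge> 2"
  shows "\<exists>a b. dihedral_like (dicyclic_group n) a b (2 * n) n n"
proof -
  let ?R = "dicyclic_relations n"
  have "dihedral_like (presented_group ?R) (word_class ?R [Gen gen_a]) (word_class ?R [Gen gen_b]) (2 * n) n n"
  proof (rule dihedral_like_presented_group)
    show "word_eq ?R [Gen gen_b, Gen gen_b] (replicate n (Gen gen_a))"
      by (rule word_eq.sym, rule word_eq_relation) (simp add: dicyclic_relations_def)
  qed (use assms order_dicyclic_group[of n] in
      \<open>auto simp: dicyclic_group_def dicyclic_relations_def intro!: word_eq_relation\<close>)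
  then show ?thesis unfolding dicyclic_group_def by blast
qed

lemma dihedral_like_dihedral_group:
  assumes "n \<ge> 2"
  shows "\<exists>a b. dihedral_like (dihedral_group n) a b n 0 n"
proof -
  let ?R = "dihedral_relations n"
  have bb: "word_eq ?R [Gen gen_b, Gen gen_b] []"
    and bab: "word_eq ?R [Gen gen_b, Gen gen_a, Gen gen_b] [Inv gen_a]"
    by (rule word_eq_relation, simp add: dihedral_relations_def)+
  have "dihedral_like (presented_group ?R) (word_class ?R [Gen gen_a]) (word_class ?R [Gen gen_b]) n 0 n"
  proof (rule dihedral_like_presented_group)
    show "word_eq ?R [Gen gen_b, Gen gen_a] [Inv gen_a, Gen gen_b]"
      using word_eq_append_left[OF bb, of "[Gen gen_b, Gen gen_a]"]
        word_eq_append_right[OF bab, of "[Gen gen_b]"]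
      by (auto intro: word_eq.sym word_eq.trans)
    show "word_eq ?R [Gen gen_b, Gen gen_b] (replicate 0 (Gen gen_a))" using bb by simp
  qed (use assms order_dihedral_group[of n] in
      \<open>auto simp: dihedral_group_def dihedral_relations_def intro!: word_eq_relation\<close>)
  then show ?thesis unfolding dihedral_group_def by blast
qed

section \<open>The Laplacian in coordinates\<close>

text \<open>Formulated without any group, so that the Laplacians of both groups are instances of one
  operator and can be compared directly.\<close>

definition coord_laplacian :: "nat \<Rightarrow> nat \<Rightarrow> (int \<times> bool \<Rightarrow> complex) \<Rightarrow> int \<times> bool \<Rightarrow> complex" where
  "coord_laplacian n N F c = (\<Sum>j\<in>{0..<int N}. \<Sum>f\<in>UNIV. if adj n c (j, f) then F c - F (j, f) else 0)"

context dihedral_like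
begin

definition coord :: "'g \<Rightarrow> int \<times> bool" where
  "coord = inv_into coords el"

lemma coord_el: "c \<in> coords \<Longrightarrow> coord (el c) = c"
  using el_bij by (simp add: coord_def bij_betw_def inv_into_f_f)

lemma sum_carrier: "(\<Sum>x\<in>carrier G. g x) = (\<Sum>c\<in>coords. g (el c))"
  using sum.reindex_bij_betw[OF el_bij, of g] by simp

lemma sum_laplacian_coords:
  assumes "c \<in> coords"
  shows "(\<Sum>u\<in>carrier G. laplacian_entry (generating_graph G) (el c) u * F (coord u)) =
    coord_laplacian n N F c"
proof -
  have fin: "finite (carrier G)" by (simp flip: el_image)
  have "(\<Sum>u\<in>carrier G. laplacian_entry (generating_graph G) (el c) u * F (coord u)) =
      (\<Sum>u\<in>{u\<in>carrier G. (el c, u) \<in> parcs (generating_graph G)}. F (coord (el c)) - F (coord u))"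
    using fin by (intro sum_laplacian_entry) (auto simp: generating_graph_def)
  also have "\<dots> = (\<Sum>u\<in>carrier G. if (el c, u) \<in> parcs (generating_graph G)
      then F (coord (el c)) - F (coord u) else 0)"
    using fin by (simp add: sum.inter_filter)
  also have "\<dots> = (\<Sum>d\<in>coords. if adj n c d then F c - F d else 0)"
    unfolding sum_carrier using assms by (intro sum.cong) (auto simp: coord_el parcs_generating_graph)
  also have "\<dots> = coord_laplacian n N F c"
    unfolding coord_laplacian_def coords_def by (simp only: sum.cartesian_product split_def prod.collapse)
  finally show ?thesis .
qed

lemma spectrum_laplacian_coords:
  fixes lam :: "'j \<Rightarrow> complex"
  assumes vs: "distinct vs" "set vs = carrier G"
    and J: "finite J" "card J = 2 * N"
    and eig: "\<And>j c. j \<in> J \<Longrightarrow> c \<in> coords \<Longrightarrow> coord_laplacian n N (F j) c = lam j * F j c"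
    and orth: "\<And>j k. j \<in> J \<Longrightarrow> k \<in> J \<Longrightarrow> j \<noteq> k \<Longrightarrow> (\<Sum>c\<in>coords. F j c * cnj (F k c)) = 0"
    and nz: "\<And>j. j \<in> J \<Longrightarrow> \<exists>c\<in>coords. F j c \<noteq> 0"
  shows "spectrum_mset (laplacian_matrix (generating_graph G) vs) = (\<Sum>j\<in>J. {#lam j#})"
  unfolding spectrum_mset_def
proof (rule proots_char_poly_orthogonal_basis[where f = "\<lambda>j x. F j (coord x)"])
  show "card J = length vs"
    using order vs J(2) by (simp add: Coset.order_def flip: distinct_card)
  show "(\<Sum>u\<in>set vs. laplacian_entry (generating_graph G) v u * F j (coord u)) = lam j * F j (coord v)"
    if "j \<in> J" "v \<in> set vs" for j v
  proof -
    obtain c where "c \<in> coords" "v = el c" using \<open>v \<in> set vs\<close> vs el_image by (metis imageE)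
    then show ?thesis using that vs by (simp add: sum_laplacian_coords eig coord_el)
  qed
  show "(\<Sum>u\<in>set vs. F j (coord u) * cnj (F k (coord u))) = 0" if "j \<in> J" "k \<in> J" "j \<noteq> k" for j k
    using orth[OF that] by (simp add: vs sum_carrier coord_el)
  show "\<exists>u\<in>set vs. F j (coord u) \<noteq> 0" if "j \<in> J" for j
    using nz[OF that] vs by (metis coord_el el_closed)
qed (use vs J in \<open>simp_all add: laplacian_matrix_eq_mat\<close>)

lemma eigenvalue_laplacian_coords:
  assumes vs: "distinct vs" "set vs = carrier G"
  shows "eigenvalue (laplacian_matrix (generating_graph G) vs) \<theta> \<longleftrightarrow>
    (\<exists>F. (\<exists>c\<in>coords. F c \<noteq> 0) \<and> (\<forall>c\<in>coords. coord_laplacian n N F c = \<theta> * F c))"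
    (is "_ \<longleftrightarrow> ?R")
proof -
  let ?K = "laplacian_entry (generating_graph G)"
  have "eigenvalue (laplacian_matrix (generating_graph G) vs) \<theta> \<longleftrightarrow>
    (\<exists>f. (\<exists>u\<in>carrier G. f u \<noteq> 0) \<and> (\<forall>v\<in>carrier G. (\<Sum>u\<in>carrier G. ?K v u * f u) = \<theta> * f v))"
    (is "_ \<longleftrightarrow> ?L")
    unfolding eigenvalue_mat_iff[OF vs(1) laplacian_matrix_eq_mat[OF vs(1)]] vs(2) ..
  also have "?L \<longleftrightarrow> ?R"
  proof
    assume ?L
    then obtain f where f: "\<exists>u\<in>carrier G. f u \<noteq> 0"
      "\<And>v. v \<in> carrier G \<Longrightarrow> (\<Sum>u\<in>carrier G. ?K v u * f u) = \<theta> * f v" by blast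
    have el_coord: "el (coord u) = u" if "u \<in> carrier G" for u
      using that by (metis coord_el el_image imageE)
    have "coord_laplacian n N (\<lambda>c. f (el c)) c = \<theta> * f (el c)" if "c \<in> coords" for c
    proof -
      have "(\<Sum>u\<in>carrier G. ?K (el c) u * f (el (coord u))) = (\<Sum>u\<in>carrier G. ?K (el c) u * f u)"
        by (intro sum.cong) (simp_all add: el_coord)
      then show ?thesis
        using sum_laplacian_coords[OF that, of "\<lambda>c. f (el c)"] f(2)[of "el c"] by simp
    qed
    moreover have "\<exists>c\<in>coords. f (el c) \<noteq> 0" using f(1) el_image by (metis imageE)
    ultimately show ?R by (intro exI[of _ "\<lambda>c. f (el c)"]) auto
  next
    assume ?R
    then obtain F where F: "\<exists>c\<in>coords. F c \<noteq> 0"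
      "\<And>c. c \<in> coords \<Longrightarrow> coord_laplacian n N F c = \<theta> * F c" by blast
    have "(\<Sum>u\<in>carrier G. ?K v u * F (coord u)) = \<theta> * F (coord v)" if "v \<in> carrier G" for v
    proof -
      obtain c where "c \<in> coords" "v = el c" using \<open>v \<in> carrier G\<close> el_image by (metis imageE)
      then show ?thesis by (simp add: sum_laplacian_coords F(2) coord_el)
    qed
    moreover have "\<exists>u\<in>carrier G. F (coord u) \<noteq> 0" using F(1) by (metis coord_el el_closed)
    ultimately show ?L by (intro exI[of _ "\<lambda>u. F (coord u)"]) auto
  qed
  finally show ?thesis .
qed

end

lemma sum_double_period:
  "(\<Sum>j\<in>{0..<int (2 * n)}. h j) = (\<Sum>j\<in>{0..<int n}. h j + h (j + int n) :: 'a :: comm_monoid_add)"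
proof -
  have "{0..<int (2 * n)} = {0..<int n} \<union> {int n..<int (2 * n)}" by auto
  then have "(\<Sum>j\<in>{0..<int (2 * n)}. h j) = (\<Sum>j\<in>{0..<int n}. h j) + (\<Sum>j\<in>{int n..<int (2 * n)}. h j)"
    by (simp add: sum.union_disjoint)
  also have "(\<Sum>j\<in>{int n..<int (2 * n)}. h j) = (\<Sum>j\<in>{0..<int n}. h (j + int n))"
    by (rule sum.reindex_bij_witness[of _ "\<lambda>j. j + int n" "\<lambda>j. j - int n"]) auto
  finally show ?thesis by (simp add: sum.distrib)
qed

lemma coprime_mod_iff: "n > 0 \<Longrightarrow> coprime (k mod int n) (int n) \<longleftrightarrow> coprime k (int n)"
  by (subst coprime_mod_left_iff) simp_all

lemma coprime_cong_iff: "n > 0 \<Longrightarrow> [k = l] (mod int n) \<Longrightarrow> coprime k (int n) \<longleftrightarrow> coprime l (int n)"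
  by (metis cong_def coprime_mod_iff)

lemma adj_cong:
  assumes "n > 0" "[i = i'] (mod int n)" "[j = j'] (mod int n)"
  shows "adj n (i, e) (j, f) \<longleftrightarrow> adj n (i', e) (j', f)"
  using assms coprime_cong_iff[OF assms(1,2)] coprime_cong_iff[OF assms(1,3)]
    coprime_cong_iff[OF assms(1) cong_diff[OF assms(2,3)]]
  by (simp add: adj_def)

text \<open>Every summand has period \<open>n\<close> in the exponent, so folding the range of
  length \<open>2 * n\<close> onto one of length \<open>n\<close> counts each of them twice.\<close>

lemma coord_laplacian_double:
  assumes "n > 0"
  shows "coord_laplacian n (2 * n) (\<lambda>(i, e). F (i mod int n, e)) (i, e) =
    2 * coord_laplacian n n F (i mod int n, e)"
proof -
  let ?g = "\<lambda>j. \<Sum>f\<in>UNIV. if adj n (i, e) (j, f) then F (i mod int n, e) - F (j mod int n, f) else 0"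
  have per: "?g (j + int n) = ?g j" for j
    using adj_cong[OF assms, of i i "j + int n" j] by (simp add: cong_def cong: if_cong)
  have "coord_laplacian n (2 * n) (\<lambda>(i, e). F (i mod int n, e)) (i, e) = (\<Sum>j\<in>{0..<int (2 * n)}. ?g j)"
    unfolding coord_laplacian_def split_conv ..
  also have "\<dots> = 2 * (\<Sum>j\<in>{0..<int n}. ?g j)"
    unfolding sum_double_period per by (simp add: sum_distrib_left)
  also have "(\<Sum>j\<in>{0..<int n}. ?g j) = coord_laplacian n n F (i mod int n, e)"
    unfolding coord_laplacian_def
    using adj_cong[OF assms, of i "i mod int n"] by (intro sum.cong) (auto simp: cong_def)
  finally show ?thesis .
qed

section \<open>The eigenbasis\<close>

lemma coprime_mod_double:
  assumes "n > 0"
  shows "coprime (k mod int (2 * n)) (int n) \<longleftrightarrow> coprime k (int n)"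
proof (rule coprime_cong_iff[OF assms])
  have "int n dvd int (2 * n)" by simp
  then show "[k mod int (2 * n) = k] (mod int n)" unfolding cong_def by (rule mod_mod_cancel)
qed

lemma sum_unity_root_eq_0:
  assumes "1 \<le> k" "k < n"
  shows "(\<Sum>t\<in>{0..<int n}. unity_root n (int k * t)) = 0"
  using assms by (subst sum_unity_root) (auto dest: dvd_imp_le)

lemma sum_unity_root_orthogonal:
  assumes "k < n" "l < n" "k \<noteq> l"
  shows "(\<Sum>t\<in>{0..<int n}. unity_root n (int k * t) * unity_root n (- (int l * t))) = 0"
proof -
  have "\<not> int n dvd int k - int l"
    using assms dvd_imp_le_int[of "int k - int l" "int n"] by auto
  then have "(\<Sum>t\<in>{0..<int n}. unity_root n ((int k - int l) * t)) = 0"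
    using assms by (subst sum_unity_root) auto
  then show ?thesis by (simp add: left_diff_distrib flip: unity_root_add)
qed

lemma coord_laplacian_rotation:
  "coord_laplacian n N F (i, False) =
    (if coprime i (int n) then \<Sum>j\<in>{0..<int N}. F (i, False) - F (j, True) else 0)"
  by (simp add: coord_laplacian_def UNIV_bool adj_def)

text \<open>Adjacent reflections are reindexed by the difference \<open>k\<close> of exponents. The
  second sum becomes a convolution over a set independent of \<open>i\<close>, and a character of
  Z/2n can be factored out of it.\<close>

lemma coord_laplacian_reflection:
  assumes "n > 0"
  shows "coord_laplacian n (2 * n) F (i, True) =
    (\<Sum>k\<in>units_double n. F (i, True) - F (k, False)) +
    (\<Sum>k\<in>units_double n. F (i, True) - F ((i - k) mod int (2 * n), True))"
proof -
  let ?R = "{0..<int (2 * n)}"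
  have "coord_laplacian n (2 * n) F (i, True) =
      (\<Sum>j\<in>?R. if coprime j (int n) then F (i, True) - F (j, False) else 0) +
      (\<Sum>j\<in>?R. if coprime (i - j) (int n) then F (i, True) - F (j, True) else 0)"
    by (simp add: coord_laplacian_def UNIV_bool adj_def sum.distrib)
  also have "(\<Sum>j\<in>?R. if coprime j (int n) then F (i, True) - F (j, False) else 0) =
      (\<Sum>k\<in>units_double n. F (i, True) - F (k, False))"
    unfolding units_double_def by (rule sum.inter_filter[symmetric]) simp
  also have "(\<Sum>j\<in>?R. if coprime (i - j) (int n) then F (i, True) - F (j, True) else 0) =
      (\<Sum>j\<in>{j\<in>?R. coprime (i - j) (int n)}. F (i, True) - F (j, True))"
    by (rule sum.inter_filter[symmetric]) simp
  also have "\<dots> = (\<Sum>k\<in>units_double n. F (i, True) - F ((i - k) mod int (2 * n), True))"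
  proof -
    have inv: "(i - (i - k) mod int (2 * n)) mod int (2 * n) = k" if "k \<in> ?R" for k
      using that by (simp add: mod_simps)
    have range: "k mod int (2 * n) \<in> ?R" for k
      using assms by simp
    have cop: "coprime (i - (i - k) mod int (2 * n)) (int n) \<longleftrightarrow> coprime k (int n)" for k
    proof -
      have "(i - (i - k) mod int (2 * n)) mod int (2 * n) = k mod int (2 * n)"
        by (simp add: mod_simps)
      then show ?thesis using coprime_mod_double[OF assms] by metis
    qed
    show ?thesis
      by (rule sum.reindex_bij_witness[of _ "\<lambda>k. (i - k) mod int (2 * n)" "\<lambda>j. (i - j) mod int (2 * n)"])
        (simp_all only: units_double_def mem_Collect_eq inv range cop coprime_mod_double[OF assms] simp_thms)
  qed
  finally show ?thesis .
qed

text \<open>The numbers attached to \<open>Rotation\<close> and \<open>Reflection\<close> are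
  indices of characters and start at 1; \<open>Constant\<close> and \<open>Difference\<close> stand
  in for the two trivial ones. The integer of \<open>Isolated\<close> is an exponent.\<close>

datatype eigen_index = Isolated int | Rotation nat | Reflection nat | Constant | Difference

text \<open>A rotation prime to \<open>n\<close> has degree \<open>2 * n\<close>, and a reflection
  has degree \<open>2 * p = 4 * totient n\<close>, half of it from rotations and half from
  reflections. These degrees account for the eigenvalue on rotations and for the constant from which
  \<open>double_ramanujan\<close> is subtracted.\<close>

lemma (in dihedral_like) spectrum_laplacian_double:
  assumes N: "N = 2 * n" and vs: "distinct vs" "set vs = carrier G"
  shows "spectrum_mset (laplacian_matrix (generating_graph G) vs) =
    replicate_mset (2 * (n - totient n) + 1) 0
    + (\<Sum>m\<in>{1..<2 * n}. {#4 * of_nat (totient n) - double_ramanujan n m#})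
    + replicate_mset (2 * totient n - 1) (2 * of_nat n)
    + replicate_mset 1 (2 * (of_nat n + of_nat (totient n)))"
proof -
  define p where "p = 2 * totient n"
  define U where "U = units_double n"
  define R where "R = {0..<int (2 * n)}"
  have n: "n > 0" using n_ge_2 by simp
  have p: "p > 0" using n by (simp add: p_def)
  have fin: "finite U" "finite R" by (simp_all add: U_def R_def)
  have UR: "U \<subseteq> R" by (auto simp: U_def R_def units_double_def)
  have U_iff: "i \<in> U \<longleftrightarrow> coprime i (int n)" if "i \<in> R" for i
    using that by (simp add: U_def R_def units_double_def)
  have cardU: "card U = p" by (simp add: U_def p_def card_units_double)
  have cardR: "card R = 2 * n" by (simp add: R_def)
  \<comment> \<open>Any bijection will do: the vertices in \<open>U\<close> share the same
    neighbours, so the group structure of the exponents is irrelevant and \<open>U\<close> may be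
    treated as Z/p.\<close>
  obtain \<rho> where \<rho>: "bij_betw \<rho> U {0..<int p}"
    using finite_same_card_bij[of U "{0..<int p}"] fin cardU by auto

  define gam :: "eigen_index \<Rightarrow> int \<Rightarrow> complex" where
    "gam x i = (case x of Rotation k \<Rightarrow> unity_root p (int k * \<rho> i) | Constant \<Rightarrow> 1
      | Difference \<Rightarrow> of_nat (2 * n) | _ \<Rightarrow> 0)" for x i
  define del :: "eigen_index \<Rightarrow> int \<Rightarrow> complex" where
    "del x i = (case x of Isolated j \<Rightarrow> if i = j then 1 else 0 | _ \<Rightarrow> 0)" for x i
  \<comment> \<open>The minus sign makes the value at \<open>i - k\<close> equal to the value at
    \<open>i\<close> times \<open>unity_root (2 * n) (int m * k)\<close>, so that summing over
    \<open>k\<close> yields \<open>double_ramanujan n m\<close> itself.\<close>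
  define bet :: "eigen_index \<Rightarrow> int \<Rightarrow> complex" where
    "bet x i = (case x of Reflection m \<Rightarrow> unity_root (2 * n) (- (int m * i)) | Constant \<Rightarrow> 1
      | Difference \<Rightarrow> - of_nat p | _ \<Rightarrow> 0)" for x i
  define F where "F x c = (if snd c then bet x (fst c) else if fst c \<in> U then gam x (fst c) else del x (fst c))"
    for x c
  define lam :: "eigen_index \<Rightarrow> complex" where
    "lam x = (case x of Isolated _ \<Rightarrow> 0 | Rotation _ \<Rightarrow> 2 * of_nat n
      | Reflection m \<Rightarrow> 4 * of_nat (totient n) - double_ramanujan n m
      | Constant \<Rightarrow> 0 | Difference \<Rightarrow> 2 * (of_nat n + of_nat (totient n)))" for x
  define J where "J = Isolated ` (R - U) \<union> Rotation ` {1..<p} \<union> Reflection ` {1..<2 * n} \<union> {Constant, Difference}"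

  have sum_U: "(\<Sum>i\<in>U. h (\<rho> i)) = (\<Sum>t\<in>{0..<int p}. h t)" for h :: "int \<Rightarrow> complex"
    by (rule sum.reindex_bij_betw[OF \<rho>])
  have U1: "(\<Sum>i\<in>U. unity_root p (int k * \<rho> i)) = 0" if "1 \<le> k" "k < p" for k
    using sum_U[of "\<lambda>t. unity_root p (int k * t)"] sum_unity_root_eq_0[OF that] by simp
  have U2: "(\<Sum>i\<in>U. unity_root p (- (int k * \<rho> i))) = 0" if "1 \<le> k" "k < p" for k
    using arg_cong[OF U1[OF that], of cnj] by (simp add: cnj_unity_root)
  have U3: "(\<Sum>i\<in>U. unity_root p (int k * \<rho> i) * unity_root p (- (int l * \<rho> i))) = 0"
    if "k < p" "l < p" "k \<noteq> l" for k l
    using sum_U[of "\<lambda>t. unity_root p (int k * t) * unity_root p (- (int l * t))"]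
      sum_unity_root_orthogonal[OF that] by simp
  have R1: "(\<Sum>i\<in>R. unity_root (2 * n) (int m * i)) = 0" if "1 \<le> m" "m < 2 * n" for m
    using sum_unity_root_eq_0[OF that] by (simp add: R_def)
  have R2: "(\<Sum>i\<in>R. unity_root (2 * n) (- (int m * i))) = 0" if "1 \<le> m" "m < 2 * n" for m
    using arg_cong[OF R1[OF that], of cnj] by (simp add: cnj_unity_root)
  have R3: "(\<Sum>i\<in>R. unity_root (2 * n) (- (int l * i)) * unity_root (2 * n) (int k * i)) = 0"
    if "k < 2 * n" "l < 2 * n" "l \<noteq> k" for k l
    using sum_unity_root_orthogonal[of k "2 * n" l] that by (simp add: R_def mult.commute)

  have coords_eq: "coords = R \<times> UNIV" unfolding coords_def by (simp add: N R_def)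
  have coords_sum: "(\<Sum>c\<in>coords. h c) = (\<Sum>i\<in>U. h (i, False)) + (\<Sum>i\<in>R - U. h (i, False)) + (\<Sum>i\<in>R. h (i, True))"
    for h :: "int \<times> bool \<Rightarrow> complex"
  proof -
    have "(\<Sum>c\<in>coords. h c) = (\<Sum>i\<in>R. \<Sum>e\<in>UNIV. h (i, e))"
      by (simp add: coords_eq sum.cartesian_product)
    also have "\<dots> = (\<Sum>i\<in>R. h (i, False)) + (\<Sum>i\<in>R. h (i, True))"
      by (simp add: UNIV_bool sum.distrib)
    also have "(\<Sum>i\<in>R. h (i, False)) = (\<Sum>i\<in>U. h (i, False)) + (\<Sum>i\<in>R - U. h (i, False))"
      using sum.subset_diff[OF UR fin(2), of "\<lambda>i. h (i, False)"] by (simp add: add.commute)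
    finally show ?thesis .
  qed
  have mem_J: "x \<in> J \<longleftrightarrow> (case x of Isolated j \<Rightarrow> j \<in> R - U | Rotation k \<Rightarrow> 1 \<le> k \<and> k < p
      | Reflection m \<Rightarrow> 1 \<le> m \<and> m < 2 * n | _ \<Rightarrow> True)" for x
    by (cases x) (auto simp: J_def)

  have sum_J: "(\<Sum>x\<in>J. h x) = (\<Sum>j\<in>R - U. h (Isolated j)) + (\<Sum>k\<in>{1..<p}. h (Rotation k))
      + (\<Sum>m\<in>{1..<2 * n}. h (Reflection m)) + (h Constant + h Difference)"
    for h :: "eigen_index \<Rightarrow> 'z :: comm_monoid_add"
  proof -
    have "(\<Sum>x\<in>J. h x) = (\<Sum>x\<in>Isolated ` (R - U). h x) + (\<Sum>x\<in>Rotation ` {1..<p}. h x)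
        + (\<Sum>x\<in>Reflection ` {1..<2 * n}. h x) + (\<Sum>x\<in>{Constant, Difference}. h x)"
      unfolding J_def using fin by (subst sum.union_disjoint, (auto)[3])+ simp
    then show ?thesis by (simp add: sum.reindex inj_on_def)
  qed

  have "spectrum_mset (laplacian_matrix (generating_graph G) vs) = (\<Sum>x\<in>J. {#lam x#})"
  proof (rule spectrum_laplacian_coords[OF vs, where F = F])
    show "finite J" using fin by (simp add: J_def)
    have "card J = (\<Sum>x\<in>J. 1)" by simp
    also have "\<dots> = card (R - U) + (p - 1) + (2 * n - 1) + 2" unfolding sum_J by simp
    also have "card (R - U) = 2 * n - p" using card_Diff_subset[OF fin(1) UR] cardU cardR by simp
    \<comment> \<open>The contributions add up to \<open>4 * n\<close>; the truncated subtractions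
      are exact because \<open>0 < p\<close> and \<open>p \<le> 2 * n\<close>.\<close>
    finally show "card J = 2 * N" using p n totient_le[of n] unfolding N p_def by linarith
  next
    fix x c assume x: "x \<in> J" and c: "c \<in> coords"
    obtain i e where ie: "c = (i, e)" by (cases c)
    then have i: "i \<in> R" using c by (simp add: coords_eq)
    show "coord_laplacian n N (F x) c = lam x * F x c"
    proof (cases e)
      case False
      show ?thesis
      proof (cases "i \<in> U")
        case True
        have "coord_laplacian n N (F x) c = (\<Sum>j\<in>R. gam x i - bet x j)"
          using False True i by (simp add: ie coord_laplacian_rotation U_iff F_def N R_def)
        also have "\<dots> = 2 * of_nat n * gam x i - (\<Sum>j\<in>R. bet x j)"
          by (simp add: sum_subtractf cardR)
        \<comment> \<open>Only \<open>Constant\<close> and \<open>Difference\<close> have a nonzero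
          sum over the reflections; for \<open>Difference\<close> it is \<open>- 2 * n * p\<close>,
          which raises the eigenvalue from \<open>2 * n\<close> to \<open>2 * n + p\<close>.\<close>
        also have "\<dots> = lam x * gam x i"
          using x by (cases x; simp add: mem_J gam_def bet_def lam_def R2 cardR p_def)
            (simp_all add: algebra_simps)
        finally show ?thesis using False True by (simp add: ie F_def)
      next
        case nU: False
        have "lam x * del x i = 0" by (cases x) (simp_all add: lam_def del_def)
        then show ?thesis using False nU i by (simp add: ie coord_laplacian_rotation U_iff F_def)
      qed
    next
      case True
      have "coord_laplacian n N (F x) c = (\<Sum>k\<in>U. bet x i - gam x k) + (\<Sum>k\<in>U. bet x i - bet x ((i - k) mod int (2 * n)))"
        using True by (simp add: ie N coord_laplacian_reflection[OF n] F_def U_def)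
      also have "\<dots> = 2 * of_nat p * bet x i - (\<Sum>k\<in>U. gam x k) - (\<Sum>k\<in>U. bet x ((i - k) mod int (2 * n)))"
        by (simp add: sum_subtractf cardU)
      also have "\<dots> = lam x * bet x i"
      proof (cases x)
        case (Reflection m)
        have "unity_root (2 * n) (- (int m * ((i - k) mod int (2 * n)))) =
            unity_root (2 * n) (- (int m * i)) * unity_root (2 * n) (int m * k)" for k
        proof -
          have "unity_root (2 * n) (- (int m * ((i - k) mod int (2 * n)))) = unity_root (2 * n) (- (int m * (i - k)))"
            using n
            by (intro unity_root_cong cong_minus_minus_iff[THEN iffD2] cong_mult cong_refl)
              (simp_all add: cong_def)
          then show ?thesis by (simp add: right_diff_distrib flip: unity_root_add)
        qed
        then have "(\<Sum>k\<in>U. bet x ((i - k) mod int (2 * n))) = bet x i * double_ramanujan n m"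
          by (simp add: Reflection bet_def double_ramanujan_def U_def sum_distrib_left)
        then show ?thesis by (simp add: Reflection gam_def lam_def p_def algebra_simps)
      next
        case (Rotation k)
        then show ?thesis using x U1[of k] by (simp add: mem_J gam_def bet_def)
      qed (use x in \<open>simp_all add: mem_J gam_def bet_def lam_def cardU p_def algebra_simps\<close>)
      finally show ?thesis using True by (simp add: ie F_def)
    qed
  next
    fix x y assume xy: "x \<in> J" "y \<in> J" "x \<noteq> y"
    have "(\<Sum>c\<in>coords. F x c * cnj (F y c)) = (\<Sum>i\<in>U. gam x i * cnj (gam y i))
        + (\<Sum>i\<in>R - U. del x i * cnj (del y i)) + (\<Sum>i\<in>R. bet x i * cnj (bet y i))"
      unfolding coords_sum by (simp add: F_def)
    also have "(\<Sum>i\<in>R - U. del x i * cnj (del y i)) = 0"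
      using xy(3) by (intro sum.neutral) (auto simp: del_def split: eigen_index.splits)
    \<comment> \<open>For \<open>Constant\<close> against \<open>Difference\<close> the two sums are
      \<open>p * 2 * n\<close> and \<open>- 2 * n * p\<close>: the weights of
      \<open>Difference\<close> are the sizes of the opposite classes.\<close>
    also have "(\<Sum>i\<in>U. gam x i * cnj (gam y i)) + 0 + (\<Sum>i\<in>R. bet x i * cnj (bet y i)) = 0"
      using xy by (cases x; cases y)
        (simp_all add: mem_J gam_def bet_def cnj_unity_root U1 U2 U3 R1 R2 R3 cardU cardR
          sum_distrib_left[symmetric] sum_distrib_right[symmetric] sum_negf)
    finally show "(\<Sum>c\<in>coords. F x c * cnj (F y c)) = 0" .
  next
    fix x assume x: "x \<in> J"
    have 1: "1 \<in> U" using n by (auto simp: U_def units_double_def)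
    have c: "(0, True) \<in> coords" "(1, False) \<in> coords" using n by (auto simp: coords_eq R_def)
    show "\<exists>c\<in>coords. F x c \<noteq> 0"
    proof (cases x)
      case (Isolated j)
      then have "(j, False) \<in> coords" "F x (j, False) \<noteq> 0"
        using x by (auto simp: mem_J F_def del_def coords_eq)
      then show ?thesis by blast
    next
      case (Rotation k)
      then have "F x (1, False) \<noteq> 0" using 1 by (simp add: F_def gam_def)
      then show ?thesis using c by blast
    qed (use c(1) p in \<open>auto simp: F_def bet_def intro!: bexI[of _ "(0, True)"]\<close>)
  qed
  also have "\<dots> = replicate_mset (2 * n - p) 0 + replicate_mset (p - 1) (2 * of_nat n)
      + (\<Sum>m\<in>{1..<2 * n}. {#4 * of_nat (totient n) - double_ramanujan n m#})
      + ({#0#} + {#2 * (of_nat n + of_nat (totient n))#})"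
  proof -
    have single: "(\<Sum>a\<in>A. {#b#}) = replicate_mset (card A) b" if "finite A" for A :: "'z set" and b :: complex
      using sum_replicate_mset_same[OF that, of "\<lambda>_. 1" b] by simp
    have "card (R - U) = 2 * n - p" using card_Diff_subset[OF fin(1) UR] cardU cardR by simp
    then show ?thesis unfolding sum_J using fin by (simp add: lam_def single)
  qed
  \<comment> \<open>The eigenvalue 0 of \<open>Constant\<close> joins those of the isolated
    rotations, which accounts for the \<open>+ 1\<close> in its multiplicity.\<close>
  also have "replicate_mset (2 * n - p) (0 :: complex) + A + B + ({#0#} + C) =
      replicate_mset (2 * (n - totient n) + 1) 0 + B + A + C" for A B C
    by (simp add: p_def diff_mult_distrib2)
  finally show ?thesis by (simp add: p_def)
qed

theorem theorem4p13:
  fixes n n\<^sub>0 \<tau> :: nat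
    and d :: "nat \<Rightarrow> nat"
    and vsQ vsD :: "gen2 word set list"
    and LQ LD :: "complex mat"
  assumes n: "n \<ge> 2"
    and n\<^sub>0: "n\<^sub>0 = \<Prod>{p. prime p \<and> p dvd n}"
    and \<tau>: "\<tau> = card {k. k dvd n\<^sub>0}"
    and d: "strict_mono_on {1..\<tau>} d" "d ` {1..\<tau>} = {k. k dvd n\<^sub>0}"
    and vsQ: "distinct vsQ" "set vsQ = carrier (dicyclic_group n)"
    and vsD: "distinct vsD" "set vsD = carrier (dihedral_group n)"
    and LQ: "LQ = laplacian_matrix (generating_graph (dicyclic_group n)) vsQ"
    and LD: "LD = laplacian_matrix (generating_graph (dihedral_group n)) vsD"
  shows "(\<forall>\<theta>. eigenvalue LD \<theta> \<longrightarrow> eigenvalue LQ (2 * \<theta>)) \<and>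
    spectrum_mset LQ =
      replicate_mset (2 * (n - totient n) + 1) 0
      + (\<Sum>i\<in>{2..\<tau>}. replicate_mset (totient (d i))
          (4 * of_nat (totient n)
           - 2 * of_int (moebius_mu (d i)) * of_nat (totient n) / of_nat (totient (d i))))
      + replicate_mset (2 * n - n\<^sub>0) (4 * of_nat (totient n))
      + replicate_mset (2 * totient n - 1) (2 * of_nat n)
      + replicate_mset 1 (2 * (of_nat n + of_nat (totient n)))"
proof -
  have n_pos: "n > 0" using n by simp
  obtain aQ bQ where "dihedral_like (dicyclic_group n) aQ bQ (2 * n) n n"
    using dihedral_like_dicyclic_group[OF n] by blast
  then interpret Q: dihedral_like "dicyclic_group n" aQ bQ "2 * n" n n .
  obtain aD bD where "dihedral_like (dihedral_group n) aD bD n 0 n"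
    using dihedral_like_dihedral_group[OF n] by blast
  then interpret D: dihedral_like "dihedral_group n" aD bD n 0 n .
  have "eigenvalue LQ (2 * \<theta>)" if "eigenvalue LD \<theta>" for \<theta>
  proof -
    obtain F where F: "\<exists>c\<in>D.coords. F c \<noteq> 0"
      "\<And>c. c \<in> D.coords \<Longrightarrow> coord_laplacian n n F c = \<theta> * F c"
      using \<open>eigenvalue LD \<theta>\<close> unfolding LD D.eigenvalue_laplacian_coords[OF vsD] by blast
    \<comment> \<open>The pullback of \<open>F\<close> along the quotient map from the dicyclic to
      the dihedral group that kills the \<open>n\<close>-th power of the rotation.\<close>
    let ?F = "\<lambda>(i, e). F (i mod int n, e)"
    have "coord_laplacian n (2 * n) ?F c = 2 * \<theta> * ?F c" for c
    proof -
      obtain i e where c: "c = (i, e)" by (cases c)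
      have "(i mod int n, e) \<in> D.coords" using n_pos by (simp add: D.coords_def)
      then show ?thesis unfolding c coord_laplacian_double[OF n_pos] by (simp add: F(2))
    qed
    moreover have "\<exists>c\<in>Q.coords. ?F c \<noteq> 0"
    proof -
      obtain i e where "(i, e) \<in> D.coords" "F (i, e) \<noteq> 0" using F(1) by auto
      \<comment> \<open>Exponents below \<open>n\<close> are fixed by the reduction, so the pullback
        agrees with \<open>F\<close> there and is not zero.\<close>
      then have "(i, e) \<in> Q.coords" "?F (i, e) \<noteq> 0" by (auto simp: D.coords_def Q.coords_def)
      then show ?thesis by blast
    qed
    ultimately show ?thesis unfolding LQ Q.eigenvalue_laplacian_coords[OF vsQ] by blast
  qed
  then show ?thesis
    unfolding LQ Q.spectrum_laplacian_double[OF HOL.refl vsQ]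
      mset_double_ramanujan[OF n_pos n\<^sub>0 \<tau> d]
    by (auto simp only: add.assoc)
qed

end
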